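(* Let $B,\delta,L_0>0$. There is a constant $C_A(B,\delta,L_0)$, given by the explicit formula in the context, such that for all $f,g\in C^2(\mathbb R/L_0\mathbb Z)$ with $\|f\|_{C^2}+\|g\|_{C^2}\le B$ and, pointwise, $f^2+(f')^2\ge\delta^2$ and $g^2+(g')^2\ge\delta^2$, there is a global sign $\varepsilon\in\{\pm1\}$ (independent of the point) with $$\|f-\varepsilon g\|_{L^1}\le C_A(B,\delta,L_0)\,\rho\bigl(\|f^2-g^2\|_{C^0}\bigr).$$ The modulus $\rho$ cannot be replaced by the identity: there are fixed $B,\delta,L_0>0$, a constant $c>0$, and a family of pairs $(f_\epsilon,g_\epsilon)$, $0<\epsilon\le\epsilon_0$, of functions in $C^2(\mathbb R/L_0\mathbb Z)$ satisfying, with these fixed $B,\delta,L_0$, $\|f_\epsilon\|_{C^2}+\|g_\epsilon\|_{C^2}\le B$ and, pointwise, $f_\epsilon^2+(f_\epsilon')^2\ge\delta^2$ and $g_\epsilon^2+(g_\epsilon')^2\ge\delta^2$, such that $\eta_\epsilon=\|f_\epsilon^2-g_\epsilon^2\|_{C^0}>0$ tends to $0$ as $\epsilon\to0$ and $$\inf_{\varepsilon=\pm1}\|f_\epsilon-\varepsilon g_\epsilon\|_{L^1}\ \ge\ c\,\eta_\epsilon\log\frac1{\eta_\epsilon}$$ for all sufficiently small $\epsilon$.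
   Context: Functions are real-valued. $\|u\|_{C^k}=\sum_{j\le k}\|u^{(j)}\|_{C^0}$; $\|u\|_{L^1}=\int_{\mathbb R/L_0\mathbb Z}|u|$ (unnormalised). $\rho(0)=0$, $\rho(t)=t(1+\log_+\frac1t)$ for $t>0$, with $\log_+\frac1t=\max\{0,\ln\frac1t\}$. The constant is $$C_A=\frac{2BL_0}{\eta_0}+\frac{L_0}{2\delta}+\frac{2BL_0}{\delta^2}+\frac{L_0}{a_0}+N_*\Bigl(\frac{32B}{\delta^2}+4Bc_1^2+\frac2\delta\bigl(1+|\ln(r\sqrt{2B\delta})|\bigr)\Bigr),$$ with $r=\frac{\delta}{4B}$, $a_0=\frac{\delta^2}{16B}$, $N_*=\frac{2BL_0}{\delta}$, $c_1=\max\{\frac4\delta,\frac1{\sqrt{2B\delta}}\}$, $\eta_0=\frac{\delta^4}{512B^2}$. *)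

theory Defs
  imports "HOL-Analysis.Analysis" "HOL-Library.Periodic_Fun"
begin

(* Functions on the circle R/LZ are represented by L-periodic functions on the real line. *)
definition Ck_circle :: "nat \<Rightarrow> real \<Rightarrow> (real \<Rightarrow> real) set" where
  "Ck_circle k L = {f. periodic_fun_simple f L \<and>
     (\<forall>j<k. (deriv ^^ j) f differentiable_on UNIV) \<and>
     continuous_on UNIV ((deriv ^^ k) f)}"

(* A supremum in the conditionally complete order of the reals:
   meaningful only for bounded functions, but continuous periodic functions are bounded. *)
definition C0_norm :: "(real \<Rightarrow> real) \<Rightarrow> real" where
  "C0_norm u = (SUP x. \<bar>u x\<bar>)"

definition Ck_norm :: "nat \<Rightarrow> (real \<Rightarrow> real) \<Rightarrow> real" where
  "Ck_norm k u = (\<Sum>j\<le>k. C0_norm ((deriv ^^ j) u))"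

(* Unnormalised L1 norm of an L-periodic function: [0, L] is a fundamental domain. *)
definition L1_norm :: "real \<Rightarrow> (real \<Rightarrow> real) \<Rightarrow> real" where
  "L1_norm L u = integral {0..L} (\<lambda>x. \<bar>u x\<bar>)"

definition log_plus :: "real \<Rightarrow> real" where
  "log_plus t = max 0 (ln t)"

(* Only used for nonnegative arguments. *)
definition rho :: "real \<Rightarrow> real" where
  "rho t = (if t = 0 then 0 else t * (1 + log_plus (1 / t)))"

definition C_A :: "real \<Rightarrow> real \<Rightarrow> real \<Rightarrow> real" where
  "C_A B \<delta> L0 =
    (let r = \<delta> / (4 * B);
         a0 = \<delta>^2 / (16 * B);
         N = 2 * B * L0 / \<delta>;
         c1 = max (4 / \<delta>) (1 / sqrt (2 * B * \<delta>));
         \<eta>0 = \<delta>^4 / (512 * B^2)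
     in 2 * B * L0 / \<eta>0 + L0 / (2 * \<delta>) + 2 * B * L0 / \<delta>^2 + L0 / a0
        + N * (32 * B / \<delta>^2 + 4 * B * c1^2
               + 2 / \<delta> * (1 + \<bar>ln (r * sqrt (2 * B * \<delta>))\<bar>)))"

definition admissible_pair ::
  "real \<Rightarrow> real \<Rightarrow> real \<Rightarrow> (real \<Rightarrow> real) \<Rightarrow> (real \<Rightarrow> real) \<Rightarrow> bool" where
  "admissible_pair B \<delta> L f g \<longleftrightarrow>
     f \<in> Ck_circle 2 L \<and> g \<in> Ck_circle 2 L \<and>
     Ck_norm 2 f + Ck_norm 2 g \<le> B \<and>
     (\<forall>x. (f x)^2 + (deriv f x)^2 \<ge> \<delta>^2) \<and>
     (\<forall>x. (g x)^2 + (deriv g x)^2 \<ge> \<delta>^2)"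

definition sq_gap :: "(real \<Rightarrow> real) \<Rightarrow> (real \<Rightarrow> real) \<Rightarrow> real" where
  "sq_gap f g = C0_norm (\<lambda>x. (f x)^2 - (g x)^2)"

end

theory Submission
  imports Defs
begin

text \<open>
  Put \<open>h = f\<^sup>2 - g\<^sup>2\<close> and \<open>\<eta> = \<parallel>h\<parallel>\<close>. Landau's inequality makes \<open>k = f f' - g g' = h'/2\<close> of order
  \<open>\<surd>\<eta>\<close>. The inner product \<open>W = f g + f' g'\<close> satisfies \<open>g W = f (f\<^sup>2 + f'\<^sup>2) - f h - f' k\<close>
  and its mirror image, so for small \<open>\<eta>\<close> a zero of \<open>W\<close> would force both \<open>f\<close> and \<open>g\<close> to be
  small, contradicting \<open>\<bar>f g\<bar> = \<bar>f' g'\<bar>\<close> and nondegeneracy. Hence \<open>W\<close> has a constant sign, which is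
  the global sign. Say \<open>W > 0\<close>. Where \<open>f g \<ge> 0\<close> we get \<open>\<bar>f - g\<bar> \<le> min(\<surd>\<eta>, \<eta>/\<bar>f\<bar>)\<close>; where
  \<open>f g < 0\<close> the same identities show that \<open>f\<close> and \<open>g\<close> are \<open>O(\<surd>\<eta>)\<close>.

  The remaining integrals of functions \<open>\<phi>(f)\<close> need no counting of zeros: with \<open>\<Phi>' = \<phi>\<close>,
  \<open>\<delta>\<^sup>2 \<phi>(f) \<le> \<phi>(f) f\<^sup>2 + \<phi>(f) f'\<^sup>2 = \<phi>(f) f\<^sup>2 + (\<Phi>(f) f')' - \<Phi>(f) f''\<close>, and the exact derivative
  integrates to zero over a period. For \<open>\<phi>(s) = 1/\<surd>(s\<^sup>2 + \<eta>)\<close> the primitive is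
  \<open>arsinh (s/\<surd>\<eta>)\<close>, which is the source of the logarithm.

  For sharpness take \<open>sin \<plusminus> p/2\<close> with \<open>p = e\<^sup>3 sin / (sin\<^sup>2 + e\<^sup>2)\<close>.
\<close>

section \<open>Functions on the circle\<close>

lemma Ck_circle_2D:
  assumes "f \<in> Ck_circle 2 L"
  shows "periodic_fun_simple f L"
    and "(f has_real_derivative deriv f x) (at x)"
    and "(deriv f has_real_derivative deriv (deriv f) x) (at x)"
    and "continuous_on UNIV (deriv (deriv f))"
proof -
  have *: "periodic_fun_simple f L" "\<forall>j<2. (deriv ^^ j) f differentiable_on UNIV"
    "continuous_on UNIV ((deriv ^^ 2) f)"
    using assms by (auto simp: Ck_circle_def)
  show "periodic_fun_simple f L" by fact
  have "(deriv ^^ 0) f differentiable_on UNIV" "(deriv ^^ 1) f differentiable_on UNIV"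
    using *(2) by (metis zero_less_numeral, metis one_less_numeral_iff semiring_norm(76))
  then show "(f has_real_derivative deriv f x) (at x)"
    "(deriv f has_real_derivative deriv (deriv f) x) (at x)"
    by (auto simp: differentiable_on_def DERIV_deriv_iff_real_differentiable)
  show "continuous_on UNIV (deriv (deriv f))"
    using *(3) by (simp add: eval_nat_numeral)
qed

lemma periodic_fun_simple_deriv:
  fixes f :: "real \<Rightarrow> real"
  assumes "periodic_fun_simple f L"
  shows "periodic_fun_simple (deriv f) L"
proof
  fix x
  interpret periodic_fun_simple f L by fact
  show "deriv f (x + L) = deriv f x"
    by (simp add: deriv_def DERIV_shift plus_period)
qed

text \<open>A supremum of reals bounds its members only once the range is known to be bounded.
  Periodicity places the whole range in the image of the compact interval \<open>{0..L}\<close>,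
  which settles this.\<close>

lemma abs_le_C0_norm:
  assumes "periodic_fun_simple u L" "L > 0" "continuous_on UNIV u"
  shows "\<bar>u x\<bar> \<le> C0_norm u"
proof -
  interpret periodic_fun_simple u L by fact
  have "compact ((\<lambda>x. \<bar>u x\<bar>) ` {0..L})"
    by (intro compact_continuous_image continuous_intros continuous_on_subset[OF assms(3)]) auto
  moreover have "range (\<lambda>x. \<bar>u x\<bar>) \<subseteq> (\<lambda>x. \<bar>u x\<bar>) ` {0..L}"
  proof safe
    fix x
    \<comment> \<open>\<open>y\<close> is the representative of \<open>x\<close> modulo
      \<open>L\<close> in the fundamental domain.\<close>
    define y where "y = x - of_int \<lfloor>x / L\<rfloor> * L"
    have "of_int \<lfloor>x / L\<rfloor> \<le> x / L" "x / L \<le> of_int \<lfloor>x / L\<rfloor> + 1" by linarith+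
    then have "of_int \<lfloor>x / L\<rfloor> * L \<le> x" "x \<le> (of_int \<lfloor>x / L\<rfloor> + 1) * L"
      using \<open>L > 0\<close> by (simp_all only: pos_le_divide_eq pos_divide_le_eq)
    then have "y \<in> {0..L}"
      by (simp add: y_def algebra_simps)
    moreover have "u y = u x"
      unfolding y_def by (rule minus_of_int)
    ultimately show "\<bar>u x\<bar> \<in> (\<lambda>x. \<bar>u x\<bar>) ` {0..L}" by (metis imageI)
  qed
  ultimately have "bdd_above (range (\<lambda>x. \<bar>u x\<bar>))"
    by (meson bdd_above_mono bounded_imp_bdd_above compact_imp_bounded)
  then show ?thesis
    unfolding C0_norm_def by (rule cSUP_upper2) auto
qed

lemma Ck_norm_2: "Ck_norm 2 f = C0_norm f + C0_norm (deriv f) + C0_norm (deriv (deriv f))"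
  by (simp add: Ck_norm_def eval_nat_numeral)

lemma C0_norm_le: "(\<And>x. \<bar>u x\<bar> \<le> K) \<Longrightarrow> C0_norm u \<le> K"
  unfolding C0_norm_def by (rule cSUP_least) auto

lemma Ck_circle_2I:
  assumes "periodic_fun_simple f L"
    and f: "\<And>x. (f has_real_derivative f' x) (at x)" "\<And>x. (f' has_real_derivative f'' x) (at x)"
    and "continuous_on UNIV f''"
  shows "f \<in> Ck_circle 2 L" "deriv f = f'" "deriv f' = f''"
proof -
  show deriv: "deriv f = f'" "deriv f' = f''"
    using f by (auto intro: DERIV_imp_deriv)
  have "f differentiable_on UNIV" "f' differentiable_on UNIV"
    using f by (auto simp: differentiable_on_def real_differentiable_def)
  then show "f \<in> Ck_circle 2 L"
    using assms(1,4) by (simp add: Ck_circle_def eval_nat_numeral less_Suc_eq deriv)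
qed

lemma Ck_circle_2_abs_le:
  assumes "f \<in> Ck_circle 2 L" "L > 0"
  shows "\<bar>f x\<bar> \<le> C0_norm f" "\<bar>deriv f x\<bar> \<le> C0_norm (deriv f)"
    "\<bar>deriv (deriv f) x\<bar> \<le> C0_norm (deriv (deriv f))"
proof -
  note D = Ck_circle_2D[OF assms(1)]
  have "continuous_on UNIV f" "continuous_on UNIV (deriv f)"
    using D(2,3) by (blast intro: DERIV_continuous_on)+
  then show "\<bar>f x\<bar> \<le> C0_norm f" "\<bar>deriv f x\<bar> \<le> C0_norm (deriv f)"
    "\<bar>deriv (deriv f) x\<bar> \<le> C0_norm (deriv (deriv f))"
    using D(1,4) assms(2) by (auto intro!: abs_le_C0_norm periodic_fun_simple_deriv)
qed

section \<open>Pointwise estimates\<close>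

text \<open>A slope \<open>p = h' x > 0\<close> can decay at rate at most \<open>M\<close>, so over
  the length \<open>p / M\<close> the function rises by at least \<open>p^2 / (2 * M)\<close>. The
  rise cannot exceed \<open>2 * \<eta>\<close>.\<close>

lemma landau_interpolation:
  fixes h :: "real \<Rightarrow> real"
  assumes h: "\<And>x. (h has_real_derivative h' x) (at x)" "\<And>x. (h' has_real_derivative h'' x) (at x)"
    and bounds: "\<And>x. \<bar>h x\<bar> \<le> \<eta>" "\<And>x. \<bar>h'' x\<bar> \<le> M" and "M > 0"
  shows "(h' x)\<^sup>2 \<le> 4 * M * \<eta>"
proof -
  have *: "(h' x)\<^sup>2 \<le> 4 * M * \<eta>"
    if "h' x \<ge> 0" "\<And>x. (h has_real_derivative h' x) (at x)" "\<And>x. (h' has_real_derivative h'' x) (at x)"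
      "\<And>x. \<bar>h x\<bar> \<le> \<eta>" "\<And>x. \<bar>h'' x\<bar> \<le> M" for h h' h'' :: "real \<Rightarrow> real" and x
  proof -
    \<comment> \<open>\<open>k\<close> is \<open>h\<close> minus the increment of the extremal
      parabola with initial slope \<open>h' x\<close> and second derivative \<open>- M\<close>; it
      is nondecreasing for \<open>t \<ge> 0\<close>. The choice of \<open>t\<close> below is the
      vertex of that parabola, where the guaranteed rise is largest.\<close>
    define k where "k t = h (x + t) - t * h' x + M * t\<^sup>2 / 2" for t
    define t where "t = h' x / M"
    have slope: "h' x - M * s \<le> h' (x + s)" if "s \<ge> 0" for s
    proof -
      have "h' x + M * x \<le> h' (x + s) + M * (x + s)"
      proof (rule DERIV_nonneg_imp_nondecreasing[of x "x + s" "\<lambda>y. h' y + M * y"])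
        fix y
        have "((\<lambda>y. h' y + M * y) has_real_derivative h'' y + M) (at y)"
          by (auto intro!: derivative_eq_intros \<open>\<And>x. (h' has_real_derivative h'' x) (at x)\<close>)
        moreover have "h'' y + M \<ge> 0"
          using \<open>\<And>x. \<bar>h'' x\<bar> \<le> M\<close>[of y] by linarith
        ultimately show "\<exists>z. ((\<lambda>y. h' y + M * y) has_real_derivative z) (at y) \<and> 0 \<le> z" by blast
      qed (use that in auto)
      then show ?thesis by (simp add: algebra_simps)
    qed
    have "t \<ge> 0" using that(1) \<open>M > 0\<close> by (simp add: t_def)
    have "k 0 \<le> k t"
    proof (rule DERIV_nonneg_imp_nondecreasing[OF \<open>t \<ge> 0\<close>])
      fix s :: real assume "0 \<le> s"
      have "(k has_real_derivative h' (x + s) - h' x + M * s) (at s)"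
        unfolding k_def
        by (auto intro!: derivative_eq_intros DERIV_chain2[OF that(2)])
      then show "\<exists>z. (k has_real_derivative z) (at s) \<and> 0 \<le> z"
        using slope[OF \<open>0 \<le> s\<close>] by (intro exI[of _ "h' (x + s) - h' x + M * s"]) auto
    qed
    then have "t * h' x - M * t\<^sup>2 / 2 \<le> 2 * \<eta>"
      using that(4)[of x] that(4)[of "x + t"] by (auto simp: k_def abs_le_iff)
    moreover have "t * h' x - M * t\<^sup>2 / 2 = (h' x)\<^sup>2 / (2 * M)"
      using \<open>M > 0\<close> by (simp add: t_def field_simps power2_eq_square)
    ultimately show ?thesis
      using \<open>M > 0\<close> by (simp add: field_simps)
  qed
  show ?thesis
  proof (cases "h' x \<ge> 0")
    case True
    then show ?thesis using * h bounds by blast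
  next
    case False
    then show ?thesis
      \<comment> \<open>A negative slope of \<open>h\<close> is a positive slope of
        \<open>- h\<close>.\<close>
      using *[of "\<lambda>x. - h' x" x "\<lambda>x. - h x" "\<lambda>x. - h'' x"] h bounds
      by (auto intro!: derivative_intros)
  qed
qed

section \<open>Algebra of the inner product \<open>f * g + f' * g'\<close>\<close>

text \<open>Here \<open>f'\<close> and \<open>g'\<close> are arbitrary reals. When they are
  derivatives, \<open>k\<close> is half the derivative of \<open>h\<close>, so both correction terms
  are controlled by the gap of the squares.\<close>

lemma inner_with_square_gap:
  fixes f f' g g' :: real
  defines "h \<equiv> f\<^sup>2 - g\<^sup>2" and "k \<equiv> f * f' - g * g'"
  shows "g * (f * g + f' * g') = f * (f\<^sup>2 + f'\<^sup>2) - f * h - f' * k"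
    and "f * (f * g + f' * g') = g * (g\<^sup>2 + g'\<^sup>2) + g * h + g' * k"
  unfolding h_def k_def by algebra+

text \<open>At a zero of the inner product the identities read \<open>f * n = f * h + f' * k\<close>
  with \<open>n = f^2 + f'^2\<close>. Cauchy-Schwarz gives \<open>f^2 * n \<le> h^2 + k^2\<close>,
  so \<open>f\<close>, and likewise \<open>g\<close>, is at most \<delta>/2 in size. Then
  \<open>f'\<close> and \<open>g'\<close> are too large for
  \<open>f * g = - f' * g'\<close>.\<close>

lemma inner_nonzero:
  fixes f f' g g' \<delta> :: real
  assumes "\<delta> > 0" "f\<^sup>2 + f'\<^sup>2 \<ge> \<delta>\<^sup>2" "g\<^sup>2 + g'\<^sup>2 \<ge> \<delta>\<^sup>2"
    and gap: "(f\<^sup>2 - g\<^sup>2)\<^sup>2 + (f * f' - g * g')\<^sup>2 \<le> (\<delta>\<^sup>2)\<^sup>2 / 4"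
  shows "f * g + f' * g' \<noteq> 0"
proof
  assume W: "f * g + f' * g' = 0"
  have small: "4 * a\<^sup>2 \<le> \<delta>\<^sup>2"
    if "a * (a\<^sup>2 + a'\<^sup>2) = a * h + a' * k" "a\<^sup>2 + a'\<^sup>2 \<ge> \<delta>\<^sup>2" "h\<^sup>2 + k\<^sup>2 \<le> (\<delta>\<^sup>2)\<^sup>2 / 4" for a a' h k :: real
  proof -
    let ?n = "a\<^sup>2 + a'\<^sup>2"
    have "?n > 0" using that(2) \<open>\<delta> > 0\<close> by (meson less_le_trans zero_less_power)
    have "a\<^sup>2 * ?n * ?n = (a * h + a' * k)\<^sup>2"
      unfolding that(1)[symmetric] by algebra
    \<comment> \<open>Cauchy-Schwarz, with Lagrange's identity supplying the nonnegative
      defect.\<close>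
    also have "\<dots> \<le> ?n * (h\<^sup>2 + k\<^sup>2)"
    proof -
      have "?n * (h\<^sup>2 + k\<^sup>2) - (a * h + a' * k)\<^sup>2 = (a * k - a' * h)\<^sup>2" by algebra
      then show ?thesis by (smt (verit) zero_le_power2)
    qed
    finally have "a\<^sup>2 * ?n \<le> h\<^sup>2 + k\<^sup>2"
      using \<open>?n > 0\<close> by (metis mult.commute mult_le_cancel_left_pos)
    moreover have "a\<^sup>2 * \<delta>\<^sup>2 \<le> a\<^sup>2 * ?n" using that(2) by (simp add: mult_left_mono)
    ultimately have "a\<^sup>2 * \<delta>\<^sup>2 \<le> \<delta>\<^sup>2 / 4 * \<delta>\<^sup>2" using that(3) by (simp add: power2_eq_square)
    then have "a\<^sup>2 \<le> \<delta>\<^sup>2 / 4"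
      by (rule mult_right_le_imp_le) (use \<open>\<delta> > 0\<close> in simp)
    then show ?thesis by simp
  qed
  have f: "4 * f\<^sup>2 \<le> \<delta>\<^sup>2"
    using inner_with_square_gap(1)[where f=f and g=g and f'=f' and g'=g'] W assms
    by (intro small[of f f' "f\<^sup>2 - g\<^sup>2" "f * f' - g * g'"]) auto
  \<comment> \<open>The mirrored identity carries \<open>h\<close> and \<open>k\<close> with the
    opposite sign.\<close>
  have g: "4 * g\<^sup>2 \<le> \<delta>\<^sup>2"
    using inner_with_square_gap(2)[where f=f and g=g and f'=f' and g'=g'] W assms
    by (intro small[of g g' "- (f\<^sup>2 - g\<^sup>2)" "- (f * f' - g * g')"]) (auto simp: algebra_simps power2_commute)
  have d: "\<delta>\<^sup>2 > 0" using \<open>\<delta> > 0\<close> by simp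
  \<comment> \<open>The common value is at most \<open>\<delta>^4 / 16\<close> by the
    \<open>f * g\<close> side and at least \<open>9 * \<delta>^4 / 16\<close> by the other.\<close>
  have "f\<^sup>2 * g\<^sup>2 = f'\<^sup>2 * g'\<^sup>2"
    using W by algebra
  moreover have "f\<^sup>2 * g\<^sup>2 \<le> (\<delta>\<^sup>2 / 4) * (\<delta>\<^sup>2 / 4)"
    using f g by (intro mult_mono) auto
  moreover have "(3 * \<delta>\<^sup>2 / 4) * (3 * \<delta>\<^sup>2 / 4) \<le> f'\<^sup>2 * g'\<^sup>2"
    using f g assms(2,3) by (intro mult_mono) auto
  moreover have "\<delta>\<^sup>2 * \<delta>\<^sup>2 > 0" using d by simp
  ultimately show False by simp
qed

text \<open>A positive inner product with \<open>f * g < 0\<close> forces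
  \<open>f' * g' > 0\<close>, so \<open>f * f'\<close> and \<open>g * g'\<close> have opposite signs
  and no cancellation occurs in their difference \<open>k\<close>: each is at most
  \<open>\<bar>k\<bar>\<close> in size. Multiplying the two identities by \<open>f\<close> and
  \<open>g\<close> and discarding the negative term \<open>f * g * W\<close> bounds \<open>f\<close>
  and \<open>g\<close> by \<open>k\<close>.\<close>

lemma opposite_signs_bound:
  fixes f f' g g' \<delta> \<eta> :: real
  assumes "f\<^sup>2 + f'\<^sup>2 \<ge> \<delta>\<^sup>2" "g\<^sup>2 + g'\<^sup>2 \<ge> \<delta>\<^sup>2" "\<bar>f\<^sup>2 - g\<^sup>2\<bar> \<le> \<eta>"
    and "f * g + f' * g' > 0" "f * g < 0"
  shows "f\<^sup>2 * (\<delta>\<^sup>2 - \<eta>) \<le> (f * f' - g * g')\<^sup>2" "g\<^sup>2 * (\<delta>\<^sup>2 - \<eta>) \<le> (f * f' - g * g')\<^sup>2"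
proof -
  define h k where "h = f\<^sup>2 - g\<^sup>2" and "k = f * f' - g * g'"
  have neg: "(f * f') * (g * g') < 0"
  proof -
    have "(f * g) * (f' * g') < 0" using assms(4,5) mult_neg_pos[of "f * g" "f' * g'"] by linarith
    then show ?thesis by (simp add: mult_ac)
  qed
  have "k\<^sup>2 - (f * f') * k = (g * g')\<^sup>2 - (f * f') * (g * g')" unfolding k_def by algebra
  then have kf: "(f * f') * k \<le> k\<^sup>2" using neg by (smt (verit) zero_le_power2)
  have "k\<^sup>2 + (g * g') * k = (f * f')\<^sup>2 - (f * f') * (g * g')" unfolding k_def by algebra
  then have kg: "- (g * g') * k \<le> k\<^sup>2" using neg by (smt (verit) zero_le_power2 mult_minus_left)
  have W: "f * g * (f * g + f' * g') < 0"
    using assms(4,5) by (simp add: mult_neg_pos)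
  have ineq: "a\<^sup>2 * (\<delta>\<^sup>2 - \<eta>) \<le> a\<^sup>2 * (n + h')"
    if "n \<ge> \<delta>\<^sup>2" "\<bar>h'\<bar> \<le> \<eta>" for a n h' :: real
    using that by (intro mult_left_mono) auto
  have "f\<^sup>2 * (\<delta>\<^sup>2 - \<eta>) \<le> f\<^sup>2 * (f\<^sup>2 + f'\<^sup>2 + - h)"
    using assms by (intro ineq) (auto simp: h_def)
  also have "\<dots> = f * g * (f * g + f' * g') + (f * f') * k"
    unfolding h_def k_def by algebra
  also have "\<dots> \<le> (f * f') * k" using W by simp
  also have "\<dots> \<le> k\<^sup>2"
    using kf by simp
  finally show "f\<^sup>2 * (\<delta>\<^sup>2 - \<eta>) \<le> (f * f' - g * g')\<^sup>2" by (simp add: k_def)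
  have "g\<^sup>2 * (\<delta>\<^sup>2 - \<eta>) \<le> g\<^sup>2 * (g\<^sup>2 + g'\<^sup>2 + h)"
    using assms by (intro ineq) (auto simp: h_def)
  also have "\<dots> = f * g * (f * g + f' * g') - (g * g') * k"
    unfolding h_def k_def by algebra
  also have "\<dots> \<le> - (g * g') * k" using W by simp
  also have "\<dots> \<le> k\<^sup>2"
    using kg by simp
  finally show "g\<^sup>2 * (\<delta>\<^sup>2 - \<eta>) \<le> (f * f' - g * g')\<^sup>2" by (simp add: k_def)
qed

text \<open>For equal signs \<open>\<bar>f + g\<bar> = \<bar>f\<bar> + \<bar>g\<bar>\<close>
  dominates both \<open>\<bar>f - g\<bar>\<close> and \<open>\<bar>f\<bar>\<close>; insert this into
  the factorisation of \<open>f^2 - g^2\<close>.\<close>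

lemma same_signs_bound:
  fixes f g :: real
  assumes "\<bar>f\<^sup>2 - g\<^sup>2\<bar> \<le> \<eta>" "f * g \<ge> 0"
  shows "(f - g)\<^sup>2 \<le> \<eta>" "\<bar>f\<bar> * \<bar>f - g\<bar> \<le> \<eta>"
proof -
  have *: "\<bar>f\<^sup>2 - g\<^sup>2\<bar> = \<bar>f - g\<bar> * \<bar>f + g\<bar>"
    by (simp add: abs_mult[symmetric] square_diff_square_factored power2_eq_square mult.commute)
  have sum: "\<bar>f + g\<bar> = \<bar>f\<bar> + \<bar>g\<bar>"
    using assms(2) by (auto simp: zero_le_mult_iff)
  have "\<bar>f\<bar> * \<bar>f - g\<bar> \<le> \<bar>f + g\<bar> * \<bar>f - g\<bar>" using sum by (intro mult_right_mono) auto
  then show "\<bar>f\<bar> * \<bar>f - g\<bar> \<le> \<eta>" using * assms(1) by (simp add: mult.commute)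
  have "\<bar>f - g\<bar> * \<bar>f - g\<bar> \<le> \<bar>f + g\<bar> * \<bar>f - g\<bar>"
    by (intro mult_right_mono) (use sum in auto)
  then show "(f - g)\<^sup>2 \<le> \<eta>" using * assms(1) by (simp add: power2_eq_square mult.commute)
qed

section \<open>Integral estimates\<close>

text \<open>Nondegeneracy trades the integral of \<open>\<phi> (f x)\<close> for an exact derivative
  plus bounded terms. \<open>P\<close> bounds the primitive along \<open>f\<close>, and
  \<open>Q\<close> bounds the part \<open>\<phi> (f x) * (f x)^2\<close>; only \<open>P\<close> will
  grow logarithmically in the first application below.\<close>

lemma integral_comp_le:
  fixes f :: "real \<Rightarrow> real"
  assumes f: "\<And>x. (f has_real_derivative f' x) (at x)" "\<And>x. (f' has_real_derivative f'' x) (at x)"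
    and per: "f L = f 0" "f' L = f' 0" and "L \<ge> 0" "\<delta> > 0"
    and nondeg: "\<And>x. (f x)\<^sup>2 + (f' x)\<^sup>2 \<ge> \<delta>\<^sup>2"
    and \<Phi>: "\<And>s. (\<Phi> has_real_derivative \<phi> s) (at s)" and \<phi>: "\<And>s. \<phi> s \<ge> 0" "continuous_on UNIV \<phi>"
    and bounds: "\<And>x. \<bar>f'' x\<bar> \<le> B" "\<And>x. \<bar>\<Phi> (f x)\<bar> \<le> P" "\<And>x. \<phi> (f x) * (f x)\<^sup>2 \<le> Q"
  shows "integral {0..L} (\<lambda>x. \<phi> (f x)) \<le> L * (P * B + Q) / \<delta>\<^sup>2"
proof -
  \<comment> \<open>\<open>D\<close> is the derivative of \<open>\<Phi> (f x) * f' x\<close>; its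
    integral over a period vanishes by \<open>per\<close>.\<close>
  define D where "D x = \<phi> (f x) * (f' x)\<^sup>2 + \<Phi> (f x) * f'' x" for x
  have "((\<lambda>x. \<Phi> (f x) * f' x) has_real_derivative D x) (at x within {0..L})" for x
    by (rule DERIV_subset[of _ _ _ UNIV])
      (auto intro!: derivative_eq_intros DERIV_chain2[OF \<Phi>] f simp: D_def power2_eq_square)
  then have "(D has_integral \<Phi> (f L) * f' L - \<Phi> (f 0) * f' 0) {0..L}"
    using \<open>L \<ge> 0\<close> by (intro fundamental_theorem_of_calculus) (auto simp: has_real_derivative_iff_has_vector_derivative)
  then have D: "(D has_integral 0) {0..L}" by (simp add: per)
  have "continuous_on {0..L} (\<lambda>x. \<phi> (f x))"
    by (intro continuous_on_compose2[OF \<phi>(2)] DERIV_continuous_on)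
      (auto intro: DERIV_subset[OF f(1)])
  then have int: "(\<lambda>x. \<phi> (f x)) integrable_on {0..L}"
    by (rule integrable_continuous_interval)
  have "integral {0..L} (\<lambda>x. \<delta>\<^sup>2 * \<phi> (f x)) \<le> integral {0..L} (\<lambda>x. (P * B + Q) + D x)"
  proof (rule integral_le)
    fix x
    have "- (\<Phi> (f x) * f'' x) \<le> \<bar>\<Phi> (f x)\<bar> * \<bar>f'' x\<bar>" by (metis abs_ge_minus_self abs_mult)
    also have "\<dots> \<le> P * B"
      using bounds(1,2)[of x] by (intro mult_mono) auto
    finally have "- (\<Phi> (f x) * f'' x) \<le> P * B" .
    moreover have "\<delta>\<^sup>2 * \<phi> (f x) \<le> ((f x)\<^sup>2 + (f' x)\<^sup>2) * \<phi> (f x)"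
      using nondeg \<phi>(1) by (intro mult_right_mono) auto
    ultimately show "\<delta>\<^sup>2 * \<phi> (f x) \<le> (P * B + Q) + D x"
      using bounds(3)[of x] by (simp add: D_def algebra_simps)
  qed (use int D in \<open>auto intro!: integrable_add integrable_on_mult_right\<close>)
  also have "\<dots> = L * (P * B + Q)"
    using D \<open>L \<ge> 0\<close> by (subst Henstock_Kurzweil_Integration.integral_add) (auto simp: integral_unique)
  finally show ?thesis
    using \<open>\<delta> > 0\<close> by (simp add: field_simps)
qed

text \<open>The first summand covers equal signs, the second opposite signs. Adding them gives one
  bound valid everywhere, so the circle need not be split according to the sign of
  \<open>f * g\<close>.\<close>

lemma pointwise_bound:
  fixes f f' g g' B \<delta> \<eta> m :: real
  assumes "\<delta> > 0" "\<eta> > 0" "m > 0" "\<eta> \<le> \<delta>\<^sup>2 / 3" and m: "\<delta>\<^sup>2 * m\<^sup>2 = 3 * B\<^sup>2 * \<eta>"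
    and "f\<^sup>2 + f'\<^sup>2 \<ge> \<delta>\<^sup>2" "g\<^sup>2 + g'\<^sup>2 \<ge> \<delta>\<^sup>2" "\<bar>f\<^sup>2 - g\<^sup>2\<bar> \<le> \<eta>"
    and k: "(f * f' - g * g')\<^sup>2 \<le> 2 * B\<^sup>2 * \<eta>" and "f * g + f' * g' > 0"
  shows "\<bar>f - g\<bar> \<le> 2 * \<eta> * (1 / sqrt (f\<^sup>2 + \<eta>)) + 4 * m\<^sup>2 * (m / (f\<^sup>2 + m\<^sup>2))"
proof (cases "f * g \<ge> 0")
  case True
  note * = same_signs_bound[OF assms(8) True]
  have pos: "f\<^sup>2 + \<eta> > 0" using assms by (simp add: add_nonneg_pos)
  \<comment> \<open>Squaring merges both same-sign estimates: one bounds the \<open>f^2\<close>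
    part, the other the \<eta> part.\<close>
  have "(\<bar>f - g\<bar> * sqrt (f\<^sup>2 + \<eta>))\<^sup>2 = (\<bar>f\<bar> * \<bar>f - g\<bar>)\<^sup>2 + (f - g)\<^sup>2 * \<eta>"
    using pos by (simp add: power_mult_distrib algebra_simps)
  also have "\<dots> \<le> \<eta>\<^sup>2 + \<eta> * \<eta>"
    using * assms by (intro add_mono power_mono mult_right_mono) auto
  also have "\<dots> \<le> (2 * \<eta>)\<^sup>2" by (simp add: power2_eq_square)
  finally have "\<bar>f - g\<bar> * sqrt (f\<^sup>2 + \<eta>) \<le> 2 * \<eta>"
    by (rule power2_le_imp_le) (use \<open>\<eta> > 0\<close> in simp)
  then have "\<bar>f - g\<bar> \<le> 2 * \<eta> * (1 / sqrt (f\<^sup>2 + \<eta>))"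
    using pos by (simp add: field_simps)
  moreover have "0 \<le> 4 * m\<^sup>2 * (m / (f\<^sup>2 + m\<^sup>2))" using assms by simp
  ultimately show ?thesis by linarith
next
  case False
  \<comment> \<open>The value of \<open>m\<close> comes from here: \<eta> is at most a third of
    \<open>\<delta>^2\<close>, so
    \<open>2 / 3 * \<delta>^2 * a^2 \<le> 2 * B^2 * \<eta>\<close>.\<close>
  have small: "\<bar>a\<bar> \<le> m" if "a\<^sup>2 * (\<delta>\<^sup>2 - \<eta>) \<le> (f * f' - g * g')\<^sup>2" for a
  proof -
    have prod: "a\<^sup>2 * (2 / 3 * \<delta>\<^sup>2) = 2 / 3 * (\<delta>\<^sup>2 * a\<^sup>2)" by simp
    have "a\<^sup>2 * (2 / 3 * \<delta>\<^sup>2) \<le> a\<^sup>2 * (\<delta>\<^sup>2 - \<eta>)"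
      using assms(4) by (intro mult_left_mono) auto
    then have "\<delta>\<^sup>2 * a\<^sup>2 \<le> \<delta>\<^sup>2 * m\<^sup>2" using that k m by (simp only: prod)
    then have "\<bar>a\<bar>\<^sup>2 \<le> m\<^sup>2" using \<open>\<delta> > 0\<close> by simp
    then show ?thesis by (rule power2_le_imp_le) (use \<open>m > 0\<close> in simp)
  qed
  have f: "\<bar>f\<bar> \<le> m" and g: "\<bar>g\<bar> \<le> m"
    using False by (auto intro!: small opposite_signs_bound[OF assms(6-8,10)])
  have "f\<^sup>2 \<le> m\<^sup>2" using f by (simp add: abs_le_square_iff[symmetric])
  \<comment> \<open>On the set \<open>\<bar>f\<bar> \<le> m\<close> this kernel is at least 1 and so
    replaces an indicator function.\<close>
  then have "1 \<le> 2 * m\<^sup>2 / (f\<^sup>2 + m\<^sup>2)"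
    using \<open>m > 0\<close> by (subst pos_le_divide_eq) (auto intro: add_nonneg_pos)
  then have "2 * m * 1 \<le> 2 * m * (2 * m\<^sup>2 / (f\<^sup>2 + m\<^sup>2))"
    using \<open>m > 0\<close> by (intro mult_left_mono) auto
  then have "\<bar>f - g\<bar> \<le> 4 * m\<^sup>2 * (m / (f\<^sup>2 + m\<^sup>2))"
    using f g by (simp add: power2_eq_square)
  moreover have "0 \<le> 2 * \<eta> * (1 / sqrt (f\<^sup>2 + \<eta>))" using assms by simp
  ultimately show ?thesis by linarith
qed

text \<open>The logarithmic contribution: here \<open>P\<close> is
  \<open>arsinh (B / sqrt \<eta>)\<close> and \<open>Q\<close> is \<open>B\<close>.\<close>

lemma arsinh_integral_bound:
  fixes f :: "real \<Rightarrow> real"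
  assumes f: "\<And>x. (f has_real_derivative f' x) (at x)" "\<And>x. (f' has_real_derivative f'' x) (at x)"
    and per: "f L = f 0" "f' L = f' 0" and "L \<ge> 0" "\<delta> > 0"
    and nondeg: "\<And>x. (f x)\<^sup>2 + (f' x)\<^sup>2 \<ge> \<delta>\<^sup>2"
    and B: "\<And>x. \<bar>f x\<bar> \<le> B" "\<And>x. \<bar>f'' x\<bar> \<le> B" and "\<eta> > 0"
  shows "integral {0..L} (\<lambda>x. 1 / sqrt ((f x)\<^sup>2 + \<eta>)) \<le> L * (arsinh (B / sqrt \<eta>) * B + B) / \<delta>\<^sup>2"
proof (rule integral_comp_le[OF f per \<open>L \<ge> 0\<close> \<open>\<delta> > 0\<close> nondeg,
      where \<phi> = "\<lambda>s. 1 / sqrt (s\<^sup>2 + \<eta>)" and \<Phi> = "\<lambda>s. arsinh (s / sqrt \<eta>)"])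
  have pos: "s\<^sup>2 + \<eta> > 0" for s using \<open>\<eta> > 0\<close> by (simp add: add_nonneg_pos)
  fix s
  have "sqrt ((s / sqrt \<eta>)\<^sup>2 + 1) = sqrt ((s\<^sup>2 + \<eta>) / \<eta>)"
    using \<open>\<eta> > 0\<close> by (simp add: power_divide add_divide_distrib)
  then show "((\<lambda>s. arsinh (s / sqrt \<eta>)) has_real_derivative 1 / sqrt (s\<^sup>2 + \<eta>)) (at s)"
    using DERIV_chain2[OF arsinh_real_has_field_derivative DERIV_cdivide[OF DERIV_ident], of "sqrt \<eta>" s UNIV]
      \<open>\<eta> > 0\<close> by (simp add: real_sqrt_divide)
  show "1 / sqrt (s\<^sup>2 + \<eta>) \<ge> 0" using pos[of s] by simp
  show "continuous_on UNIV (\<lambda>s. 1 / sqrt (s\<^sup>2 + \<eta>))"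
    using pos by (auto intro!: continuous_intros simp: less_imp_neq[THEN not_sym])
next
  fix x
  show "\<bar>f'' x\<bar> \<le> B" by fact
  have "\<bar>arsinh s\<bar> = arsinh \<bar>s\<bar>" for s :: real
    by (cases "s \<ge> 0") (simp_all add: abs_if not_le)
  then have "\<bar>arsinh (f x / sqrt \<eta>)\<bar> = arsinh (\<bar>f x\<bar> / sqrt \<eta>)" using \<open>\<eta> > 0\<close> by simp
  also have "\<dots> \<le> arsinh (B / sqrt \<eta>)"
    by (subst linorder_not_less[symmetric], subst arsinh_less_iff_real)
      (use B(1)[of x] \<open>\<eta> > 0\<close> in \<open>simp add: not_less divide_right_mono\<close>)
  finally show "\<bar>arsinh (f x / sqrt \<eta>)\<bar> \<le> arsinh (B / sqrt \<eta>)" .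
  have "(f x)\<^sup>2 \<le> \<bar>f x\<bar> * sqrt ((f x)\<^sup>2 + \<eta>)"
    using \<open>\<eta> > 0\<close> mult_left_mono[OF real_le_rsqrt[of "\<bar>f x\<bar>" "(f x)\<^sup>2 + \<eta>"], of "\<bar>f x\<bar>"]
    by (simp add: power2_eq_square)
  also have "\<dots> \<le> B * sqrt ((f x)\<^sup>2 + \<eta>)"
    using B \<open>\<eta> > 0\<close> by (intro mult_right_mono) auto
  finally show "1 / sqrt ((f x)\<^sup>2 + \<eta>) * (f x)\<^sup>2 \<le> B"
    using \<open>\<eta> > 0\<close> by (simp add: pos_divide_le_eq add_nonneg_pos)
qed

text \<open>The primitive \<open>arctan (s / m)\<close> is bounded by 2 whatever \<open>m\<close>
  is, so the region of opposite signs contributes no logarithm.\<close>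

lemma arctan_integral_bound:
  fixes f :: "real \<Rightarrow> real"
  assumes f: "\<And>x. (f has_real_derivative f' x) (at x)" "\<And>x. (f' has_real_derivative f'' x) (at x)"
    and per: "f L = f 0" "f' L = f' 0" and "L \<ge> 0" "\<delta> > 0"
    and nondeg: "\<And>x. (f x)\<^sup>2 + (f' x)\<^sup>2 \<ge> \<delta>\<^sup>2"
    and B: "\<And>x. \<bar>f x\<bar> \<le> B" "\<And>x. \<bar>f'' x\<bar> \<le> B" and "m > 0"
  shows "integral {0..L} (\<lambda>x. m / ((f x)\<^sup>2 + m\<^sup>2)) \<le> L * (2 * B + B) / \<delta>\<^sup>2"
proof (rule integral_comp_le[OF f per \<open>L \<ge> 0\<close> \<open>\<delta> > 0\<close> nondeg,
      where \<phi> = "\<lambda>s. m / (s\<^sup>2 + m\<^sup>2)" and \<Phi> = "\<lambda>s. arctan (s / m)"])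
  have pos: "s\<^sup>2 + m\<^sup>2 > 0" for s using \<open>m > 0\<close> by (simp add: add_nonneg_pos)
  fix s
  show "((\<lambda>s. arctan (s / m)) has_real_derivative m / (s\<^sup>2 + m\<^sup>2)) (at s)"
    using \<open>m > 0\<close> pos[of s]
    by (auto intro!: derivative_eq_intros simp: field_simps power2_eq_square)
  show "m / (s\<^sup>2 + m\<^sup>2) \<ge> 0" using pos[of s] \<open>m > 0\<close> by simp
  show "continuous_on UNIV (\<lambda>s. m / (s\<^sup>2 + m\<^sup>2))"
    using pos by (auto intro!: continuous_intros simp: less_imp_neq[THEN not_sym])
next
  fix x
  show "\<bar>f'' x\<bar> \<le> B" by fact
  show "\<bar>arctan (f x / m)\<bar> \<le> 2"
    using arctan_bounded[of "f x / m"] pi_less_4 by linarith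
  have "m * (f x)\<^sup>2 = \<bar>f x\<bar> * (m * \<bar>f x\<bar>)" by (simp add: power2_eq_square)
  also have "\<dots> \<le> B * ((f x)\<^sup>2 + m\<^sup>2)"
  proof (rule mult_mono)
    have "0 \<le> (m - \<bar>f x\<bar>)\<^sup>2" "0 \<le> m * \<bar>f x\<bar>" using \<open>m > 0\<close> by auto
    then show "m * \<bar>f x\<bar> \<le> (f x)\<^sup>2 + m\<^sup>2" by (simp add: power2_diff)
  qed (use B[of x] \<open>m > 0\<close> in auto)
  finally show "m / ((f x)\<^sup>2 + m\<^sup>2) * (f x)\<^sup>2 \<le> B"
    using \<open>m > 0\<close> by (simp add: divide_le_eq add_nonneg_pos)
qed

text \<open>Integrates the pointwise bound. Since \<open>m^2\<close> is proportional to \<eta>, both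
  kernels contribute at order \<eta>, the first with a logarithmic factor.\<close>

lemma L1_bound_of_positive_inner:
  fixes f g :: "real \<Rightarrow> real"
  assumes f: "\<And>x. (f has_real_derivative f' x) (at x)" "\<And>x. (f' has_real_derivative f'' x) (at x)"
    and per: "f L = f 0" "f' L = f' 0" and "L \<ge> 0" "\<delta> > 0" "B > 0"
    and nondeg: "\<And>x. (f x)\<^sup>2 + (f' x)\<^sup>2 \<ge> \<delta>\<^sup>2" "\<And>x. (g x)\<^sup>2 + (g' x)\<^sup>2 \<ge> \<delta>\<^sup>2"
    and B: "\<And>x. \<bar>f x\<bar> \<le> B" "\<And>x. \<bar>f'' x\<bar> \<le> B"
    and g: "continuous_on {0..L} g"
    and \<eta>: "0 < \<eta>" "\<eta> \<le> \<delta>\<^sup>2 / 3" and gap: "\<And>x. \<bar>(f x)\<^sup>2 - (g x)\<^sup>2\<bar> \<le> \<eta>"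
    and k: "\<And>x. (f x * f' x - g x * g' x)\<^sup>2 \<le> 2 * B\<^sup>2 * \<eta>"
    and inner: "\<And>x. f x * g x + f' x * g' x > 0"
  shows "integral {0..L} (\<lambda>x. \<bar>f x - g x\<bar>)
    \<le> \<eta> * (2 * L * B / \<delta>\<^sup>2 * (arsinh (B / sqrt \<eta>) + 1) + 36 * L * B ^ 3 / \<delta> ^ 4)"
proof -
  define m where "m = sqrt (3 * B\<^sup>2 * \<eta>) / \<delta>"
  have m: "m > 0" "\<delta>\<^sup>2 * m\<^sup>2 = 3 * B\<^sup>2 * \<eta>"
    using assms by (auto simp: m_def power_divide)
  have f_cont: "continuous_on {0..L} f"
    by (rule DERIV_continuous_on) (rule DERIV_subset[OF f(1)], simp)
  have pos: "(f x)\<^sup>2 + \<eta> > 0" "(f x)\<^sup>2 + m\<^sup>2 > 0" for x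
    using \<open>\<eta> > 0\<close> m by (simp_all add: add_nonneg_pos)
  have int: "(\<lambda>x. 1 / sqrt ((f x)\<^sup>2 + \<eta>)) integrable_on {0..L}"
    "(\<lambda>x. m / ((f x)\<^sup>2 + m\<^sup>2)) integrable_on {0..L}"
    using pos by (auto intro!: integrable_continuous_interval continuous_intros f_cont
        simp: less_imp_neq[THEN not_sym])
  have "integral {0..L} (\<lambda>x. \<bar>f x - g x\<bar>)
    \<le> integral {0..L} (\<lambda>x. 2 * \<eta> * (1 / sqrt ((f x)\<^sup>2 + \<eta>)) + 4 * m\<^sup>2 * (m / ((f x)\<^sup>2 + m\<^sup>2)))"
  proof (rule integral_le)
    show "(\<lambda>x. \<bar>f x - g x\<bar>) integrable_on {0..L}"
      by (intro integrable_continuous_interval continuous_intros f_cont g)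
    show "(\<lambda>x. 2 * \<eta> * (1 / sqrt ((f x)\<^sup>2 + \<eta>)) + 4 * m\<^sup>2 * (m / ((f x)\<^sup>2 + m\<^sup>2))) integrable_on {0..L}"
      by (intro integrable_add integrable_on_mult_right int)
  qed (rule pointwise_bound[OF \<open>\<delta> > 0\<close> \<eta>(1) m(1) \<eta>(2) m(2) nondeg gap k inner])
  also have "\<dots> = 2 * \<eta> * integral {0..L} (\<lambda>x. 1 / sqrt ((f x)\<^sup>2 + \<eta>))
      + 4 * m\<^sup>2 * integral {0..L} (\<lambda>x. m / ((f x)\<^sup>2 + m\<^sup>2))"
    by (subst Henstock_Kurzweil_Integration.integral_add)
      (auto intro!: integrable_on_mult_right int simp del: times_divide_eq_right)
  also have "\<dots> \<le> 2 * \<eta> * (L * (arsinh (B / sqrt \<eta>) * B + B) / \<delta>\<^sup>2) + 4 * m\<^sup>2 * (L * (2 * B + B) / \<delta>\<^sup>2)"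
    using \<eta> m assms
    by (intro add_mono mult_left_mono arsinh_integral_bound[OF f per] arctan_integral_bound[OF f per]) auto
  also have "4 * m\<^sup>2 * (L * (2 * B + B) / \<delta>\<^sup>2) = \<eta> * (36 * L * B ^ 3 / \<delta> ^ 4)"
  proof -
    have "m\<^sup>2 = 3 * B\<^sup>2 * \<eta> / \<delta>\<^sup>2" using m \<open>\<delta> > 0\<close> by (simp add: field_simps)
    then show ?thesis by (simp add: eval_nat_numeral mult_ac)
  qed
  finally show ?thesis by (simp add: algebra_simps add_divide_distrib)
qed

section \<open>Comparison with the explicit constant \<open>C_A\<close>\<close>

text \<open>For \<open>t \<ge> 1\<close>, \<open>arsinh t \<le> ln (3 * t)\<close>. Splitting off
  \<open>R\<close> produces exactly the logarithm that occurs in \<open>C_A\<close>; the remainder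
  is a power of \<open>B / \<delta>\<close>. The factor 1/2 comes from
  \<open>sqrt \<eta>\<close>.\<close>

lemma arsinh_scale_bound:
  fixes B \<delta> \<eta> :: real
  assumes "\<delta> > 0" "\<eta> > 0" "2 * \<delta> \<le> B" "\<eta> \<le> B\<^sup>2"
  shows "arsinh (B / sqrt \<eta>)
    \<le> log_plus (1 / \<eta>) / 2 + \<bar>ln (\<delta> / (4 * B) * sqrt (2 * B * \<delta>))\<bar> + 6 * (B / \<delta>)\<^sup>2"
proof -
  define R where "R = \<delta> / (4 * B) * sqrt (2 * B * \<delta>)"
  have "B > 0" using assms by linarith
  have "R > 0" using \<open>B > 0\<close> \<open>\<delta> > 0\<close> by (simp add: R_def)
  define t where "t = B / sqrt \<eta>"
  have "sqrt \<eta> \<le> B" using assms \<open>B > 0\<close> by (simp add: real_le_lsqrt)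
  then have t: "t \<ge> 1" using \<open>\<eta> > 0\<close> by (simp add: t_def)
  have "t\<^sup>2 + 1 \<le> (2 * t)\<^sup>2" using one_le_power[OF t, of 2] by (simp add: power_mult_distrib)
  then have "sqrt (t\<^sup>2 + 1) \<le> 2 * t" using t by (intro real_le_lsqrt) auto
  then have "arsinh t \<le> ln (3 * t)"
    unfolding arsinh_real_def using t by (subst ln_le_cancel_iff) (auto intro: add_pos_nonneg)
  also have "3 * t = inverse (sqrt \<eta>) * (R * (3 * B / R))"
    using \<open>R > 0\<close> by (simp add: t_def field_simps)
  also have "ln \<dots> = - ln \<eta> / 2 + (ln R + ln (3 * B / R))"
    using \<open>R > 0\<close> \<open>B > 0\<close> \<open>\<eta> > 0\<close> by (simp add: ln_mult_pos ln_inverse ln_sqrt ln_div)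
  also have "- ln \<eta> / 2 \<le> log_plus (1 / \<eta>) / 2"
    using \<open>\<eta> > 0\<close> by (simp add: log_plus_def ln_div)
  also have "ln R \<le> \<bar>ln R\<bar>" by simp
  also have "ln (3 * B / R) \<le> 3 * B / R"
    using \<open>R > 0\<close> \<open>B > 0\<close> by (intro less_imp_le ln_less_self) simp
  also have "3 * B / R \<le> 6 * (B / \<delta>)\<^sup>2"
  proof -
    \<comment> \<open>The assumption \<open>2 * \<delta> \<le> B\<close> bounds \<open>R\<close>
      below by \<open>\<delta>^2 / (2 * B)\<close>.\<close>
    have "2 * \<delta> * (2 * \<delta>) \<le> B * (2 * \<delta>)"
      using assms by (intro mult_right_mono) auto
    then have "2 * \<delta> \<le> sqrt (2 * B * \<delta>)"
      using \<open>\<delta> > 0\<close> by (intro real_le_rsqrt) (simp add: power2_eq_square mult_ac)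
    then have "\<delta> / (4 * B) * (2 * \<delta>) \<le> R"
      unfolding R_def using \<open>\<delta> > 0\<close> \<open>B > 0\<close> by (intro mult_left_mono) auto
    then have "3 * B / R \<le> 3 * B / (\<delta> / (4 * B) * (2 * \<delta>))"
      using \<open>\<delta> > 0\<close> \<open>B > 0\<close> by (intro divide_left_mono mult_pos_pos \<open>R > 0\<close>) auto
    then show ?thesis by (simp add: power2_eq_square)
  qed
  finally show ?thesis by (simp add: t_def R_def)
qed

text \<open>Isolates the large-gap term and the logarithmic term of a sum of nonnegative terms. The
  coefficient \<open>4 * L * B / \<delta>^2\<close> is the product of
  \<open>2 * B * L / \<delta>\<close> and \<open>2 / \<delta>\<close>.\<close>

lemma C_A_lower_bounds:
  assumes "B > 0" "\<delta> > 0" "L \<ge> 0"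
  shows "C_A B \<delta> L \<ge> 2 * B * L / (\<delta> ^ 4 / (512 * B\<^sup>2))
      + 4 * L * B / \<delta>\<^sup>2 * (1 + \<bar>ln (\<delta> / (4 * B) * sqrt (2 * B * \<delta>))\<bar>)"
proof -
  define X where "X = \<bar>ln (\<delta> / (4 * B) * sqrt (2 * B * \<delta>))\<bar>"
  define c where "c = max (4 / \<delta>) (1 / sqrt (2 * B * \<delta>))"
  have "C_A B \<delta> L = 2 * B * L / (\<delta> ^ 4 / (512 * B\<^sup>2)) + L / (2 * \<delta>) + 2 * B * L / \<delta>\<^sup>2
      + L / (\<delta>\<^sup>2 / (16 * B)) + 2 * B * L / \<delta> * (32 * B / \<delta>\<^sup>2 + 4 * B * c\<^sup>2 + 2 / \<delta> * (1 + X))"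
    by (simp only: C_A_def Let_def X_def c_def)
  also have "\<dots> = 2 * B * L / (\<delta> ^ 4 / (512 * B\<^sup>2)) + 4 * L * B / \<delta>\<^sup>2 * (1 + X)
      + (L / (2 * \<delta>) + 2 * B * L / \<delta>\<^sup>2 + L / (\<delta>\<^sup>2 / (16 * B))
        + 2 * B * L / \<delta> * (32 * B / \<delta>\<^sup>2 + 4 * B * c\<^sup>2))"
    by (simp add: distrib_left power2_eq_square)
  finally show ?thesis using assms by (simp add: X_def)
qed

lemma C_A_log_bound:
  fixes B \<delta> L \<eta> :: real
  assumes "\<delta> > 0" "\<eta> > 0" "L \<ge> 0" "2 * \<delta> \<le> B" "\<eta> \<le> B\<^sup>2"
  shows "2 * L * B / \<delta>\<^sup>2 * (arsinh (B / sqrt \<eta>) + 1) + 36 * L * B ^ 3 / \<delta> ^ 4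
    \<le> C_A B \<delta> L * (1 + log_plus (1 / \<eta>))"
proof -
  have "B > 0" using assms by linarith
  define X where "X = \<bar>ln (\<delta> / (4 * B) * sqrt (2 * B * \<delta>))\<bar>"
  define l where "l = log_plus (1 / \<eta>)"
  define p where "p = L * B / \<delta>\<^sup>2"
  define q where "q = L * B ^ 3 / \<delta> ^ 4"
  have nonneg: "p \<ge> 0" "q \<ge> 0" "X \<ge> 0" "l \<ge> 0"
    using assms \<open>B > 0\<close> by (auto simp: p_def q_def X_def l_def log_plus_def)
  have "2 * L * B / \<delta>\<^sup>2 * (arsinh (B / sqrt \<eta>) + 1) + 36 * L * B ^ 3 / \<delta> ^ 4
      = 2 * p * (arsinh (B / sqrt \<eta>) + 1) + 36 * q"
    by (simp add: p_def q_def)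
  also have "\<dots> \<le> 2 * p * ((l / 2 + X + 6 * (B / \<delta>)\<^sup>2) + 1) + 36 * q"
    using arsinh_scale_bound[OF assms(1,2,4,5)] nonneg
    by (intro add_mono mult_left_mono) (auto simp: X_def l_def)
  \<comment> \<open>The term \<open>6 * (B / \<delta>)^2\<close> multiplied by \<open>2 * p\<close>
    is \<open>12 * q\<close>. The resulting \<open>48 * q\<close> fits into \<open>1024 * q\<close>,
    which is the large-gap term of \<open>C_A\<close>.\<close>
  also have "\<dots> = 2 * p * (l / 2 + X + 1) + 48 * q"
    using \<open>\<delta> > 0\<close> by (simp add: p_def q_def field_simps eval_nat_numeral)
  also have "\<dots> \<le> (1024 * q + 4 * p * (1 + X)) * (1 + l)"
  proof -
    have "0 \<le> q * l" "0 \<le> p * X" "0 \<le> p * l" "0 \<le> p * X * l" using nonneg by auto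
    then show ?thesis using nonneg by (simp add: algebra_simps)
  qed
  also have "\<dots> \<le> C_A B \<delta> L * (1 + l)"
    using C_A_lower_bounds[OF \<open>B > 0\<close> \<open>\<delta> > 0\<close> \<open>L \<ge> 0\<close>] nonneg
    by (intro mult_right_mono) (auto simp: p_def q_def X_def eval_nat_numeral mult_ac)
  finally show ?thesis by (simp add: l_def)
qed

section \<open>The stability estimate\<close>

lemma admissible_pair_commute: "admissible_pair B \<delta> L f g \<longleftrightarrow> admissible_pair B \<delta> L g f"
  by (auto simp: admissible_pair_def)

text \<open>Bounds for the first member of a pair; symmetry gives the second. Together they yield
  \<open>2 * \<delta> \<le> B\<close>. The last expression is half the second derivative of
  \<open>f^2\<close>, as Landau's inequality will require.\<close>

lemma admissible_pair_norm_le: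
  assumes "admissible_pair B \<delta> L f g" "L > 0" "\<delta> > 0"
  shows "\<delta> \<le> Ck_norm 2 f" "0 \<le> Ck_norm 2 f" "\<bar>f x\<bar> \<le> Ck_norm 2 f" "\<bar>deriv (deriv f) x\<bar> \<le> Ck_norm 2 f"
    and "\<bar>(deriv f x)\<^sup>2 + f x * deriv (deriv f) x\<bar> \<le> (Ck_norm 2 f)\<^sup>2"
proof -
  have f: "f \<in> Ck_circle 2 L" and nondeg: "(f x)\<^sup>2 + (deriv f x)\<^sup>2 \<ge> \<delta>\<^sup>2" for x
    using assms by (auto simp: admissible_pair_def)
  note le = Ck_circle_2_abs_le[OF f \<open>L > 0\<close>]
  define a b c where "a = C0_norm f" and "b = C0_norm (deriv f)" and "c = C0_norm (deriv (deriv f))"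
  have N: "Ck_norm 2 f = a + b + c" by (simp add: Ck_norm_2 a_def b_def c_def)
  have nonneg: "a \<ge> 0" "b \<ge> 0" "c \<ge> 0"
    using le[of 0] by (auto simp: a_def b_def c_def)
  show "0 \<le> Ck_norm 2 f" "\<bar>f x\<bar> \<le> Ck_norm 2 f" "\<bar>deriv (deriv f) x\<bar> \<le> Ck_norm 2 f"
    using N nonneg le[of x] by (auto simp: a_def b_def c_def)
  have sq: "(f x)\<^sup>2 \<le> a\<^sup>2" "(deriv f x)\<^sup>2 \<le> b\<^sup>2"
    using le[of x] nonneg by (auto simp: a_def b_def abs_le_square_iff[symmetric])
  have prods: "0 \<le> a * b" "0 \<le> a * c" "0 \<le> b * c" using nonneg by auto
  have sum_sq: "(a + b + c)\<^sup>2 = a\<^sup>2 + b\<^sup>2 + c\<^sup>2 + 2 * (a * b) + 2 * (a * c) + 2 * (b * c)"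
    by algebra
  have "\<delta>\<^sup>2 \<le> (a + b + c)\<^sup>2"
    using nondeg[of x] sq prods zero_le_power2[of c] unfolding sum_sq by linarith
  then show "\<delta> \<le> Ck_norm 2 f"
    unfolding N by (rule power2_le_imp_le) (use nonneg in simp)
  have "\<bar>f x * deriv (deriv f) x\<bar> \<le> a * c"
    unfolding abs_mult a_def c_def using le by (intro mult_mono) (auto intro: order_trans[OF abs_ge_zero])
  then have "\<bar>(deriv f x)\<^sup>2 + f x * deriv (deriv f) x\<bar> \<le> b\<^sup>2 + a * c"
    using sq(2) abs_triangle_ineq[of "(deriv f x)\<^sup>2" "f x * deriv (deriv f) x"] by simp
  also have "\<dots> \<le> (a + b + c)\<^sup>2"
    using prods zero_le_power2[of a] zero_le_power2[of c] unfolding sum_sq by linarith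
  finally show "\<bar>(deriv f x)\<^sup>2 + f x * deriv (deriv f) x\<bar> \<le> (Ck_norm 2 f)\<^sup>2" by (simp add: N)
qed

text \<open>Landau's inequality for \<open>f^2 - g^2\<close>, whose derivative is twice the quantity
  bounded here and whose second derivative is at most \<open>2 * B^2\<close> in size.\<close>

lemma admissible_pair_gap_deriv:
  assumes "admissible_pair B \<delta> L f g" "L > 0" "\<delta> > 0"
  shows "\<bar>(f x)\<^sup>2 - (g x)\<^sup>2\<bar> \<le> sq_gap f g"
    and "(f x * deriv f x - g x * deriv g x)\<^sup>2 \<le> 2 * B\<^sup>2 * sq_gap f g"
proof -
  have f: "f \<in> Ck_circle 2 L" and g: "g \<in> Ck_circle 2 L" and norm: "Ck_norm 2 f + Ck_norm 2 g \<le> B"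
    using assms by (auto simp: admissible_pair_def)
  note Df = Ck_circle_2D[OF f] and Dg = Ck_circle_2D[OF g]
  note nf = admissible_pair_norm_le[OF assms]
  note ng = admissible_pair_norm_le[OF assms(1)[unfolded admissible_pair_commute[of _ _ _ f]] assms(2,3)]
  have "B > 0" using nf(1) ng(1) norm \<open>\<delta> > 0\<close> by linarith
  have "continuous_on UNIV f" "continuous_on UNIV g"
    using Df(2) Dg(2) by (blast intro: DERIV_continuous_on)+
  moreover have "periodic_fun_simple (\<lambda>x. (f x)\<^sup>2 - (g x)\<^sup>2) L"
    using Df(1) Dg(1) by (simp add: periodic_fun_simple_def)
  ultimately have gap: "\<bar>(f x)\<^sup>2 - (g x)\<^sup>2\<bar> \<le> sq_gap f g" for x
    unfolding sq_gap_def using \<open>L > 0\<close> by (intro abs_le_C0_norm) (auto intro!: continuous_intros)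
  then show "\<bar>(f x)\<^sup>2 - (g x)\<^sup>2\<bar> \<le> sq_gap f g" .
  define h' where "h' x = 2 * (f x * deriv f x - g x * deriv g x)" for x
  define h'' where "h'' x = 2 * (((deriv f x)\<^sup>2 + f x * deriv (deriv f) x)
      - ((deriv g x)\<^sup>2 + g x * deriv (deriv g) x))" for x
  have "(h' x)\<^sup>2 \<le> 4 * (2 * B\<^sup>2) * sq_gap f g"
  proof (rule landau_interpolation[where h' = h' and h'' = h'', OF _ _ gap])
    fix x
    show "((\<lambda>x. (f x)\<^sup>2 - (g x)\<^sup>2) has_real_derivative h' x) (at x)"
      by (auto intro!: derivative_eq_intros Df Dg simp: h'_def)
    show "(h' has_real_derivative h'' x) (at x)"
      unfolding h'_def
      by (auto intro!: derivative_eq_intros Df Dg simp: h''_def power2_eq_square algebra_simps)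
    have "\<bar>h'' x\<bar> \<le> 2 * ((Ck_norm 2 f)\<^sup>2 + (Ck_norm 2 g)\<^sup>2)"
      unfolding h''_def using nf(5)[of x] ng(5)[of x] by (simp add: abs_mult)
    also have "\<dots> \<le> 2 * (Ck_norm 2 f + Ck_norm 2 g)\<^sup>2"
      using nf(2) ng(2) by (simp add: power2_sum)
    also have "\<dots> \<le> 2 * B\<^sup>2"
      using norm nf(2) ng(2) by (intro mult_left_mono power_mono) auto
    finally show "\<bar>h'' x\<bar> \<le> 2 * B\<^sup>2" .
  qed (use \<open>B > 0\<close> in simp)
  then have "4 * (f x * deriv f x - g x * deriv g x)\<^sup>2 \<le> 4 * (2 * B\<^sup>2 * sq_gap f g)"
    unfolding h'_def power_mult_distrib by simp
  then show "(f x * deriv f x - g x * deriv g x)\<^sup>2 \<le> 2 * B\<^sup>2 * sq_gap f g"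
    by (rule mult_left_le_imp_le) simp
qed

lemma small_gap_le:
  fixes B \<delta> \<eta> :: real
  assumes "\<delta> > 0" "\<eta> \<ge> 0" "2 * \<delta> \<le> B" "512 * B\<^sup>2 * \<eta> \<le> \<delta> ^ 4"
  shows "2048 * \<eta> \<le> \<delta>\<^sup>2"
proof (rule mult_left_le_imp_le)
  have "(2 * \<delta>)\<^sup>2 * \<eta> \<le> B\<^sup>2 * \<eta>"
    using assms by (intro mult_right_mono power_mono) auto
  moreover have "\<delta>\<^sup>2 * (2048 * \<eta>) = 512 * ((2 * \<delta>)\<^sup>2 * \<eta>)" by (simp add: power_mult_distrib)
  moreover have "\<delta>\<^sup>2 * \<delta>\<^sup>2 = \<delta> ^ 4" by simp
  ultimately show "\<delta>\<^sup>2 * (2048 * \<eta>) \<le> \<delta>\<^sup>2 * \<delta>\<^sup>2" using assms(4) by linarith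
qed (use assms in simp)

text \<open>Below the threshold the inner product \<open>W\<close> has no zero. As it is continuous
  on the connected line, its sign is constant, which makes \<open>s\<close> independent of the
  point.\<close>

lemma admissible_pair_inner_sign:
  assumes adm: "admissible_pair B \<delta> L f g" "L > 0" "\<delta> > 0" and small: "512 * B\<^sup>2 * sq_gap f g \<le> \<delta> ^ 4"
  obtains s :: real where "s \<in> {1, -1}" "\<And>x. f x * (s * g x) + deriv f x * (s * deriv g x) > 0"
proof -
  define W where "W x = f x * g x + deriv f x * deriv g x" for x
  have f: "f \<in> Ck_circle 2 L" and g: "g \<in> Ck_circle 2 L" and norm: "Ck_norm 2 f + Ck_norm 2 g \<le> B"
    and nondeg: "\<And>x. (f x)\<^sup>2 + (deriv f x)\<^sup>2 \<ge> \<delta>\<^sup>2" "\<And>x. (g x)\<^sup>2 + (deriv g x)\<^sup>2 \<ge> \<delta>\<^sup>2"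
    using adm by (auto simp: admissible_pair_def)
  note gap = admissible_pair_gap_deriv[OF adm]
  define \<eta> where "\<eta> = sq_gap f g"
  have "\<eta> \<ge> 0" using gap(1)[of 0] by (simp add: \<eta>_def)
  have "2 * \<delta> \<le> B"
    using admissible_pair_norm_le(1)[OF adm]
      admissible_pair_norm_le(1)[OF adm(1)[unfolded admissible_pair_commute[of _ _ _ f]] adm(2,3)] norm
    by linarith
  then have \<eta>_le: "2048 * \<eta> \<le> \<delta>\<^sup>2"
    using small \<open>\<delta> > 0\<close> \<open>\<eta> \<ge> 0\<close> by (intro small_gap_le[of \<delta> \<eta> B]) (auto simp: \<eta>_def)
  have "W x \<noteq> 0" for x
    unfolding W_def
  proof (rule inner_nonzero[OF \<open>\<delta> > 0\<close> nondeg])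
    have "\<bar>(f x)\<^sup>2 - (g x)\<^sup>2\<bar> \<le> \<delta>\<^sup>2 / 4"
      using gap(1)[of x] \<eta>_le \<open>\<eta> \<ge> 0\<close> by (simp add: \<eta>_def)
    then have "\<bar>(f x)\<^sup>2 - (g x)\<^sup>2\<bar>\<^sup>2 \<le> (\<delta>\<^sup>2 / 4)\<^sup>2" by (rule power_mono) simp
    also have "\<dots> \<le> (\<delta>\<^sup>2)\<^sup>2 / 8" by (simp add: power_divide)
    finally have "((f x)\<^sup>2 - (g x)\<^sup>2)\<^sup>2 \<le> (\<delta>\<^sup>2)\<^sup>2 / 8" by simp
    moreover have "(f x * deriv f x - g x * deriv g x)\<^sup>2 \<le> \<delta> ^ 4 / 256"
      using gap(2)[of x] small by linarith
    then have "(f x * deriv f x - g x * deriv g x)\<^sup>2 \<le> (\<delta>\<^sup>2)\<^sup>2 / 8"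
      by (rule order_trans) simp
    ultimately have "((f x)\<^sup>2 - (g x)\<^sup>2)\<^sup>2 + (f x * deriv f x - g x * deriv g x)\<^sup>2
        \<le> (\<delta>\<^sup>2)\<^sup>2 / 8 + (\<delta>\<^sup>2)\<^sup>2 / 8"
      by (rule add_mono)
    then show "((f x)\<^sup>2 - (g x)\<^sup>2)\<^sup>2 + (f x * deriv f x - g x * deriv g x)\<^sup>2 \<le> (\<delta>\<^sup>2)\<^sup>2 / 4"
      by simp
  qed
  moreover have "continuous_on UNIV W"
    unfolding W_def using Ck_circle_2D(2,3)[OF f] Ck_circle_2D(2,3)[OF g]
    by (intro continuous_intros) (blast intro: DERIV_continuous_on)+
  then have "connected (range W)" by (intro connected_continuous_image) auto
  ultimately have "(\<forall>x. W x > 0) \<or> (\<forall>x. W x < 0)"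
    unfolding connected_iff_interval by (smt (verit) UNIV_I image_iff rangeI)
  then show ?thesis
  proof
    assume "\<forall>x. W x > 0"
    then show ?thesis by (intro that[of 1]) (auto simp: W_def)
  next
    assume W: "\<forall>x. W x < 0"
    show ?thesis
    proof (rule that[of "-1"])
      show "f x * (- 1 * g x) + deriv f x * (- 1 * deriv g x) > 0" for x
        using W[rule_format, of x] by (simp add: W_def)
    qed simp
  qed
qed

text \<open>Three regimes: a gap above the threshold in \<open>C_A\<close>, where the trivial bound
  suffices; gap zero; and a small positive gap, where the integral estimates apply.\<close>

lemma L1_stability:
  assumes adm: "admissible_pair B \<delta> L f g" and pos: "B > 0" "\<delta> > 0" "L > 0"
  shows "\<exists>s\<in>{1, -1 :: real}. L1_norm L (\<lambda>x. f x - s * g x) \<le> C_A B \<delta> L * rho (sq_gap f g)"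
proof -
  have f: "f \<in> Ck_circle 2 L" and g: "g \<in> Ck_circle 2 L" and norm: "Ck_norm 2 f + Ck_norm 2 g \<le> B"
    and nondeg: "\<And>x. (f x)\<^sup>2 + (deriv f x)\<^sup>2 \<ge> \<delta>\<^sup>2" "\<And>x. (g x)\<^sup>2 + (deriv g x)\<^sup>2 \<ge> \<delta>\<^sup>2"
    using adm by (auto simp: admissible_pair_def)
  note Df = Ck_circle_2D[OF f] and Dg = Ck_circle_2D[OF g]
  note nf = admissible_pair_norm_le[OF adm pos(3,2)]
  note ng = admissible_pair_norm_le[OF adm[unfolded admissible_pair_commute[of _ _ _ f]] pos(3,2)]
  note gap = admissible_pair_gap_deriv[OF adm pos(3,2)]
  define \<eta> where "\<eta> = sq_gap f g"
  have "\<eta> \<ge> 0" using gap(1)[of 0] by (simp add: \<eta>_def)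
  have "2 * \<delta> \<le> B" using nf(1) ng(1) norm by linarith
  have cont: "continuous_on {0..L} f" "continuous_on {0..L} g"
    using Df(2) Dg(2) by (blast intro: DERIV_continuous_on DERIV_subset)+
  show ?thesis
  proof (cases "512 * B\<^sup>2 * \<eta> \<le> \<delta> ^ 4")
    case False
    then have "\<eta> > 0" using pos by (smt (verit) mult_nonneg_nonpos zero_le_power2 zero_less_power)
    \<comment> \<open>Either sign would do here; the bound \<open>\<bar>f - g\<bar> \<le> B\<close>
      is absorbed because \<eta> exceeds the threshold.\<close>
    have "L1_norm L (\<lambda>x. f x - 1 * g x) \<le> integral {0..L} (\<lambda>x. B)"
      unfolding L1_norm_def
    proof (rule integral_le)
      show "\<bar>f x - 1 * g x\<bar> \<le> B" for x
        using nf(3)[of x] ng(3)[of x] norm by linarith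
    qed (auto intro!: integrable_continuous_interval continuous_intros cont)
    also have "\<dots> \<le> 2 * B * L" using pos by simp
    also have "\<dots> \<le> 2 * B * L / (\<delta> ^ 4 / (512 * B\<^sup>2)) * \<eta>"
    proof -
      have "2 * B * L * 1 \<le> 2 * B * L * (512 * B\<^sup>2 * \<eta> / \<delta> ^ 4)"
        using False pos by (intro mult_left_mono) auto
      then show ?thesis by simp
    qed
    also have "\<dots> \<le> C_A B \<delta> L * rho \<eta>"
    proof (rule mult_mono)
      show "2 * B * L / (\<delta> ^ 4 / (512 * B\<^sup>2)) \<le> C_A B \<delta> L"
        using C_A_lower_bounds[of B \<delta> L] pos
        by (smt (verit) divide_nonneg_pos mult_nonneg_nonneg zero_less_power)
      then show "0 \<le> C_A B \<delta> L" by (rule order_trans[rotated]) (use pos in simp)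
      show "\<eta> \<le> rho \<eta>"
        using \<open>\<eta> > 0\<close> by (simp add: rho_def log_plus_def mult_le_cancel_left1)
    qed (use \<open>\<eta> \<ge> 0\<close> in simp)
    finally show ?thesis by (auto simp: \<eta>_def)
  next
    case True
    then obtain s :: real where s: "s \<in> {1, -1}"
      and inner: "\<And>x. f x * (s * g x) + deriv f x * (s * deriv g x) > 0"
      using admissible_pair_inner_sign[OF adm pos(3,2)] by (metis \<eta>_def)
    have s2: "s\<^sup>2 = 1" "s * s = 1" using s by auto
    have nondeg': "(s * g x)\<^sup>2 + (s * deriv g x)\<^sup>2 \<ge> \<delta>\<^sup>2" for x
      using nondeg(2)[of x] by (simp add: power_mult_distrib s2)
    have gap': "\<bar>(f x)\<^sup>2 - (s * g x)\<^sup>2\<bar> \<le> \<eta>" for x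
      using gap(1)[of x] by (simp add: power_mult_distrib s2 \<eta>_def)
    have k: "(f x * deriv f x - s * g x * (s * deriv g x))\<^sup>2 \<le> 2 * B\<^sup>2 * \<eta>" for x
    proof -
      have "s * g x * (s * deriv g x) = s\<^sup>2 * (g x * deriv g x)" by (simp add: power2_eq_square)
      then show ?thesis using gap(2)[of x] by (simp only: \<eta>_def s2 mult_1)
    qed
    have "L1_norm L (\<lambda>x. f x - s * g x) \<le> C_A B \<delta> L * rho \<eta>"
    proof (cases "\<eta> = 0")
      case True
      \<comment> \<open>As \<open>rho 0 = 0\<close>, exact equality is required. Opposite signs are
        impossible, since they would force \<open>f x = 0\<close>.\<close>
      have "f x - s * g x = 0" for x
      proof (cases "f x * (s * g x) \<ge> 0")
        case nn: True
        show ?thesis using same_signs_bound(1)[OF gap' nn] True by simp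
      next
        case False
        have "(f x)\<^sup>2 * (\<delta>\<^sup>2 - 0) \<le> (f x * deriv f x - s * g x * (s * deriv g x))\<^sup>2"
          using opposite_signs_bound(1)[OF nondeg(1) nondeg' gap' inner] False True by simp
        then have "(f x)\<^sup>2 * \<delta>\<^sup>2 \<le> 0" using k[of x] True by simp
        then have "f x = 0" using \<open>\<delta> > 0\<close> by (simp add: mult_le_0_iff)
        then show ?thesis using False by simp
      qed
      then show ?thesis using True by (simp add: L1_norm_def rho_def)
    next
      case False
      then have "\<eta> > 0" using \<open>\<eta> \<ge> 0\<close> by simp
      have "(2 * \<delta>)\<^sup>2 \<le> B\<^sup>2" using \<open>2 * \<delta> \<le> B\<close> pos by (intro power_mono) auto
      have "2048 * \<eta> \<le> \<delta>\<^sup>2"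
        using True pos \<open>2 * \<delta> \<le> B\<close> \<open>\<eta> \<ge> 0\<close> by (intro small_gap_le[of \<delta> \<eta> B]) auto
      then have \<eta>_le: "\<eta> \<le> \<delta>\<^sup>2 / 3" "\<eta> \<le> B\<^sup>2"
        using \<open>\<eta> > 0\<close> \<open>(2 * \<delta>)\<^sup>2 \<le> B\<^sup>2\<close> by (auto simp: power_mult_distrib)
      have per: "f L = f 0" "deriv f L = deriv f 0"
        using Df(1) periodic_fun_simple_deriv[OF Df(1)] unfolding periodic_fun_simple_def
        by (force dest: spec[of _ 0])+
      have "L1_norm L (\<lambda>x. f x - s * g x)
        \<le> \<eta> * (2 * L * B / \<delta>\<^sup>2 * (arsinh (B / sqrt \<eta>) + 1) + 36 * L * B ^ 3 / \<delta> ^ 4)"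
        unfolding L1_norm_def
      proof (rule L1_bound_of_positive_inner[OF Df(2,3) per _ pos(2,1) nondeg(1) nondeg' _ _ _ \<open>\<eta> > 0\<close> \<eta>_le(1) gap' k inner])
        show "\<bar>f x\<bar> \<le> B" "\<bar>deriv (deriv f) x\<bar> \<le> B" for x
          using nf(3,4)[of x] ng(2) norm by linarith+
      qed (use pos in \<open>auto intro!: continuous_intros cont\<close>)
      also have "\<dots> \<le> \<eta> * (C_A B \<delta> L * (1 + log_plus (1 / \<eta>)))"
        using \<open>\<eta> > 0\<close> \<open>2 * \<delta> \<le> B\<close> \<eta>_le pos by (intro mult_left_mono C_A_log_bound) auto
      also have "\<dots> = C_A B \<delta> L * rho \<eta>" using \<open>\<eta> > 0\<close> by (simp add: rho_def)
      finally show ?thesis .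
    qed
    then show ?thesis using s by (auto simp: \<eta>_def)
  qed
qed

section \<open>Sharpness of the modulus\<close>

text \<open>On the scale \<open>\<bar>u\<bar> \<ge> e\<close> the profile looks like \<open>e\<^sup>3 / u\<close>, whose integral carries the logarithm;
  \<open>e\<^sup>3\<close> is the largest amplitude for which a cut-off at \<open>\<bar>u\<bar> \<approx> e\<close> keeps the second derivative bounded.\<close>

definition profile :: "real \<Rightarrow> real \<Rightarrow> real" where
  "profile e u = e ^ 3 * u / (u\<^sup>2 + e\<^sup>2)"

definition profile' :: "real \<Rightarrow> real \<Rightarrow> real" where
  "profile' e u = e ^ 3 * (e\<^sup>2 - u\<^sup>2) / (u\<^sup>2 + e\<^sup>2)\<^sup>2"

definition profile'' :: "real \<Rightarrow> real \<Rightarrow> real" where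
  "profile'' e u = 2 * e ^ 3 * u * (u\<^sup>2 - 3 * e\<^sup>2) / (u\<^sup>2 + e\<^sup>2) ^ 3"

lemma profile_has_derivative:
  assumes "e > 0"
  shows "(profile e has_real_derivative profile' e u) (at u)"
    and "(profile' e has_real_derivative profile'' e u) (at u)"
proof -
  have "u\<^sup>2 + e\<^sup>2 \<noteq> 0" using assms by (simp add: add_nonneg_eq_0_iff)
  then show "(profile e has_real_derivative profile' e u) (at u)"
    unfolding profile_def profile'_def
    by (auto intro!: derivative_eq_intros simp: power2_eq_square algebra_simps)
  let ?d = "u\<^sup>2 + e\<^sup>2"
  have "((\<lambda>u. e ^ 3 * (e\<^sup>2 - u\<^sup>2) / (u\<^sup>2 + e\<^sup>2)\<^sup>2) has_real_derivative
      ((- (e ^ 3 * (2 * u))) * ?d\<^sup>2 - e ^ 3 * (e\<^sup>2 - u\<^sup>2) * (2 * ?d * (2 * u))) / (?d\<^sup>2 * ?d\<^sup>2)) (at u)"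
    using \<open>?d \<noteq> 0\<close> by (auto intro!: derivative_eq_intros)
  moreover have "((- (e ^ 3 * (2 * u))) * ?d\<^sup>2 - e ^ 3 * (e\<^sup>2 - u\<^sup>2) * (2 * ?d * (2 * u))) / (?d\<^sup>2 * ?d\<^sup>2)
      = profile'' e u"
  proof -
    have "(- (e ^ 3 * (2 * u))) * ?d\<^sup>2 - e ^ 3 * (e\<^sup>2 - u\<^sup>2) * (2 * ?d * (2 * u))
        = ?d * (2 * e ^ 3 * u * (u\<^sup>2 - 3 * e\<^sup>2))"
      by algebra
    moreover have "?d\<^sup>2 * ?d\<^sup>2 = ?d * ?d ^ 3" by algebra
    ultimately show ?thesis using \<open>?d \<noteq> 0\<close> by (simp add: profile''_def)
  qed
  ultimately show "(profile' e has_real_derivative profile'' e u) (at u)"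
    unfolding profile'_def by simp
qed

text \<open>With \<open>d = u^2 + e^2\<close>, every expression splits into ratios such as
  \<open>e^2 / d\<close>, \<open>e * \<bar>u\<bar> / d\<close> and
  \<open>\<bar>u^2 - 3 * e^2\<bar> / d\<close>, each bounded uniformly in \<open>u\<close> and
  \<open>e\<close>.\<close>

lemma profile_bounds:
  assumes "0 < e" "e \<le> 1"
  shows "\<bar>profile e u\<bar> \<le> 1" "\<bar>profile' e u\<bar> \<le> 1" "\<bar>profile'' e u\<bar> \<le> 6" "e ^ 3 / (u\<^sup>2 + e\<^sup>2) \<le> 1"
proof -
  let ?d = "u\<^sup>2 + e\<^sup>2"
  have d: "?d > 0" "e\<^sup>2 \<le> ?d" using assms by (auto intro: add_nonneg_pos)
  have mixed: "e * \<bar>u\<bar> \<le> ?d"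
  proof -
    have "0 \<le> (e - \<bar>u\<bar>)\<^sup>2" "0 \<le> e * \<bar>u\<bar>" using assms by auto
    then show ?thesis by (simp add: power2_diff)
  qed
  have "e ^ 3 \<le> e\<^sup>2" "e\<^sup>2 \<le> 1" using assms by (auto intro: power_decreasing power_le_one)
  show le: "e ^ 3 / ?d \<le> 1" using d \<open>e ^ 3 \<le> e\<^sup>2\<close> by (simp add: divide_le_eq order_trans)
  have "e\<^sup>2 * (e * \<bar>u\<bar>) \<le> 1 * ?d"
    using mixed \<open>e\<^sup>2 \<le> 1\<close> assms by (intro mult_mono) auto
  then show "\<bar>profile e u\<bar> \<le> 1"
    using d assms by (simp add: profile_def abs_mult abs_div divide_le_eq power3_eq_cube power2_eq_square mult_ac)
  have "\<bar>e\<^sup>2 - u\<^sup>2\<bar> / ?d \<le> 1" using d by (simp add: divide_le_eq abs_le_iff)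
  then have "e ^ 3 / ?d * (\<bar>e\<^sup>2 - u\<^sup>2\<bar> / ?d) \<le> 1 * 1"
    using le d assms by (intro mult_mono) auto
  then show "\<bar>profile' e u\<bar> \<le> 1"
    using d assms by (simp add: profile'_def abs_mult power2_eq_square)
  have "\<bar>u\<^sup>2 - 3 * e\<^sup>2\<bar> / ?d \<le> 3" using d by (simp add: divide_le_eq abs_le_iff)
  moreover have "e\<^sup>2 / ?d \<le> 1" "e * \<bar>u\<bar> / ?d \<le> 1" using d mixed by (auto simp: divide_le_eq)
  ultimately have "2 * (e\<^sup>2 / ?d) * (e * \<bar>u\<bar> / ?d) * (\<bar>u\<^sup>2 - 3 * e\<^sup>2\<bar> / ?d) \<le> 2 * 1 * 1 * 3"
    using d assms by (intro mult_mono) auto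
  moreover have "2 * e ^ 3 * u * q / ?d ^ 3 = 2 * (e\<^sup>2 / ?d) * (e * u / ?d) * (q / ?d)" for q
    by (simp add: power2_eq_square power3_eq_cube)
  then have "profile'' e u = 2 * (e\<^sup>2 / ?d) * (e * u / ?d) * ((u\<^sup>2 - 3 * e\<^sup>2) / ?d)"
    by (simp only: profile''_def)
  ultimately show "\<bar>profile'' e u\<bar> \<le> 6"
    using d assms by (simp only: abs_mult abs_divide) simp
qed

section \<open>The oscillating pairs and their admissibility\<close>

text \<open>Composition with \<open>sin\<close> makes the profile periodic and smooth. The members
  with \<sigma> = 1/2 and -1/2 have sum \<open>2 * sin x\<close> and difference
  \<open>profile e (sin x)\<close>.\<close>

definition wave :: "real \<Rightarrow> real \<Rightarrow> real \<Rightarrow> real" where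
  "wave \<sigma> e x = sin x + \<sigma> * profile e (sin x)"

lemma wave_Ck_circle:
  fixes \<sigma> e :: real
  assumes "0 < e"
  shows "wave \<sigma> e \<in> Ck_circle 2 (2 * pi)"
    and "deriv (wave \<sigma> e) = (\<lambda>x. cos x * (1 + \<sigma> * profile' e (sin x)))"
    and "deriv (deriv (wave \<sigma> e))
      = (\<lambda>x. (cos x)\<^sup>2 * (\<sigma> * profile'' e (sin x)) - sin x * (1 + \<sigma> * profile' e (sin x)))"
proof -
  let ?f' = "\<lambda>x. cos x * (1 + \<sigma> * profile' e (sin x))"
  let ?f'' = "\<lambda>x. (cos x)\<^sup>2 * (\<sigma> * profile'' e (sin x)) - sin x * (1 + \<sigma> * profile' e (sin x))"
  have per: "periodic_fun_simple (wave \<sigma> e) (2 * pi)"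
    by (simp add: periodic_fun_simple_def wave_def)
  have f': "(wave \<sigma> e has_real_derivative ?f' x) (at x)" for x
    unfolding wave_def
    by (auto intro!: derivative_eq_intros DERIV_chain2[OF profile_has_derivative(1)[OF assms]] simp: algebra_simps)
  have f'': "(?f' has_real_derivative ?f'' x) (at x)" for x
    by (auto intro!: derivative_eq_intros DERIV_chain2[OF profile_has_derivative(2)[OF assms]]
        simp: algebra_simps power2_eq_square)
  have "(sin x)\<^sup>2 + e\<^sup>2 \<noteq> 0" for x using assms by (simp add: add_nonneg_eq_0_iff)
  then have "continuous_on UNIV ?f''"
    unfolding profile'_def profile''_def by (auto intro!: continuous_intros)
  note * = Ck_circle_2I[OF per f' f'' this]
  show "wave \<sigma> e \<in> Ck_circle 2 (2 * pi)" "deriv (wave \<sigma> e) = ?f'" "deriv (deriv (wave \<sigma> e)) = ?f''"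
    using * by auto
qed

text \<open>The bound is 3/2 + 3/2 + 9/2. Two such functions give the value \<open>B = 15\<close>
  used below.\<close>

lemma wave_norm_le:
  assumes "0 < e" "e \<le> 1" "\<bar>\<sigma>\<bar> \<le> 1 / 2"
  shows "Ck_norm 2 (wave \<sigma> e) \<le> 15 / 2"
proof -
  have small: "\<bar>\<sigma> * p\<bar> \<le> K / 2" if "\<bar>p\<bar> \<le> K" for p K
    using mult_mono[OF assms(3) that] by (simp add: abs_mult)
  note b = small[OF profile_bounds(1)[OF assms(1,2)]] small[OF profile_bounds(2)[OF assms(1,2)]]
    small[OF profile_bounds(3)[OF assms(1,2)]]
  have factor: "\<bar>1 + \<sigma> * profile' e u\<bar> \<le> 3 / 2" for u
    using b(2)[of u] by linarith
  have "C0_norm (wave \<sigma> e) \<le> 3 / 2"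
  proof (rule C0_norm_le)
    show "\<bar>wave \<sigma> e x\<bar> \<le> 3 / 2" for x
      using b(1)[of "sin x"] abs_sin_le_one[of x] unfolding wave_def by linarith
  qed
  moreover have "C0_norm (deriv (wave \<sigma> e)) \<le> 3 / 2"
    unfolding wave_Ck_circle(2)[OF assms(1)]
  proof (rule C0_norm_le)
    show "\<bar>cos x * (1 + \<sigma> * profile' e (sin x))\<bar> \<le> 3 / 2" for x
      using mult_mono[OF abs_cos_le_one[of x] factor[of "sin x"]] by (simp add: abs_mult)
  qed
  moreover have "C0_norm (deriv (deriv (wave \<sigma> e))) \<le> 9 / 2"
    unfolding wave_Ck_circle(3)[OF assms(1)]
  proof (rule C0_norm_le)
    fix x :: real
    have "\<bar>(cos x)\<^sup>2\<bar> \<le> 1"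
      using sin_cos_squared_add[of x] zero_le_power2[of "sin x"] unfolding abs_power2 by linarith
    then have "\<bar>(cos x)\<^sup>2 * (\<sigma> * profile'' e (sin x))\<bar> \<le> 3"
      using mult_mono[OF _ b(3)[of "sin x"], of "\<bar>(cos x)\<^sup>2\<bar>" 1] by (simp add: abs_mult)
    moreover have "\<bar>sin x * (1 + \<sigma> * profile' e (sin x))\<bar> \<le> 3 / 2"
      using mult_mono[OF abs_sin_le_one[of x] factor[of "sin x"]] by (simp add: abs_mult)
    ultimately show "\<bar>(cos x)\<^sup>2 * (\<sigma> * profile'' e (sin x)) - sin x * (1 + \<sigma> * profile' e (sin x))\<bar> \<le> 9 / 2"
      by linarith
  qed
  ultimately show ?thesis by (simp add: Ck_norm_2)
qed

text \<open>The profile is odd, so the wave is \<open>sin x\<close> times a factor at least 1/2, and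
  its derivative is \<open>cos x\<close> times another such factor. The identity for squares of sine
  and cosine finishes.\<close>

lemma wave_nondegenerate:
  assumes "0 < e" "e \<le> 1" "\<bar>\<sigma>\<bar> \<le> 1 / 2"
  shows "(wave \<sigma> e x)\<^sup>2 + (deriv (wave \<sigma> e) x)\<^sup>2 \<ge> (1 / 2)\<^sup>2"
proof -
  have ge: "(1 / 2)\<^sup>2 * y\<^sup>2 \<le> (y * (1 + \<sigma> * p))\<^sup>2" if "\<bar>p\<bar> \<le> 1" for y p
  proof -
    have "\<bar>\<sigma> * p\<bar> \<le> 1 / 2"
      using mult_mono[OF assms(3) that] by (simp add: abs_mult)
    then have "(1 / 2)\<^sup>2 \<le> (1 + \<sigma> * p)\<^sup>2" by (intro power_mono) linarith+
    then have "(1 / 2)\<^sup>2 * y\<^sup>2 \<le> (1 + \<sigma> * p)\<^sup>2 * y\<^sup>2" by (rule mult_right_mono) simp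
    then show ?thesis by (simp add: power_mult_distrib mult.commute)
  qed
  have "wave \<sigma> e x = sin x * (1 + \<sigma> * (e ^ 3 / ((sin x)\<^sup>2 + e\<^sup>2)))"
    by (simp add: wave_def profile_def algebra_simps)
  moreover have "\<bar>e ^ 3 / ((sin x)\<^sup>2 + e\<^sup>2)\<bar> \<le> 1"
    using profile_bounds(4)[OF assms(1,2)] assms by simp
  ultimately have "(1 / 2)\<^sup>2 * (sin x)\<^sup>2 \<le> (wave \<sigma> e x)\<^sup>2" by (simp only: ge)
  moreover have "(1 / 2)\<^sup>2 * (cos x)\<^sup>2 \<le> (deriv (wave \<sigma> e) x)\<^sup>2"
    unfolding wave_Ck_circle(2)[OF assms(1)] by (rule ge[OF profile_bounds(2)[OF assms(1,2)]])
  ultimately have "(1 / 2)\<^sup>2 * ((sin x)\<^sup>2 + (cos x)\<^sup>2) \<le> (wave \<sigma> e x)\<^sup>2 + (deriv (wave \<sigma> e) x)\<^sup>2"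
    by (simp add: distrib_left del: sin_cos_squared_add)
  then show ?thesis by simp
qed

lemma wave_admissible:
  assumes "0 < e" "e \<le> 1"
  shows "admissible_pair 15 (1 / 2) (2 * pi) (wave (1 / 2) e) (wave (- 1 / 2) e)"
  using wave_Ck_circle(1) wave_norm_le[of e "1 / 2"] wave_norm_le[of e "- 1 / 2"]
    wave_nondegenerate[of e "1 / 2"] wave_nondegenerate[of e "- 1 / 2"] assms
  unfolding admissible_pair_def by auto

text \<open>The gap is the sum times the difference, \<open>2 * sin x * profile e (sin x)\<close>:
  at most \<open>2 * e^3\<close> everywhere, and at least \<open>e^3\<close> at
  \<open>pi / 2\<close>.\<close>

lemma wave_sq_gap:
  assumes "0 < e" "e \<le> 1"
  shows "e ^ 3 \<le> sq_gap (wave (1 / 2) e) (wave (- 1 / 2) e)"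
    and "sq_gap (wave (1 / 2) e) (wave (- 1 / 2) e) \<le> 2 * e ^ 3"
proof -
  define h where "h x = 2 * e ^ 3 * ((sin x)\<^sup>2 / ((sin x)\<^sup>2 + e\<^sup>2))" for x
  have d: "(sin x)\<^sup>2 + e\<^sup>2 > 0" for x using assms by (simp add: add_nonneg_pos)
  have h: "(wave (1 / 2) e x)\<^sup>2 - (wave (- 1 / 2) e x)\<^sup>2 = h x" for x
  proof -
    have "(wave (1 / 2) e x)\<^sup>2 - (wave (- 1 / 2) e x)\<^sup>2 = 2 * sin x * profile e (sin x)"
      by (simp add: wave_def power2_eq_square algebra_simps)
    then show ?thesis by (simp add: profile_def h_def power2_eq_square)
  qed
  have gap: "sq_gap (wave (1 / 2) e) (wave (- 1 / 2) e) = C0_norm h"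
    by (simp only: sq_gap_def h)
  have "continuous_on UNIV h"
    unfolding h_def using d by (auto intro!: continuous_intros simp: less_imp_neq[THEN not_sym])
  moreover have "periodic_fun_simple h (2 * pi)"
    by (simp add: periodic_fun_simple_def h_def)
  ultimately have "\<bar>h (pi / 2)\<bar> \<le> C0_norm h" by (intro abs_le_C0_norm) auto
  moreover have "e ^ 3 \<le> h (pi / 2)"
  proof -
    have "e\<^sup>2 \<le> 1" using assms by (auto intro: power_le_one)
    then have "1 / 2 \<le> 1 / (1 + e\<^sup>2)" by (intro divide_left_mono) (auto intro: add_pos_nonneg)
    then have "2 * e ^ 3 * (1 / 2) \<le> 2 * e ^ 3 * (1 / (1 + e\<^sup>2))"
      using assms by (intro mult_left_mono) auto
    then show ?thesis by (simp add: h_def)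
  qed
  ultimately show "e ^ 3 \<le> sq_gap (wave (1 / 2) e) (wave (- 1 / 2) e)" unfolding gap by linarith
  have "\<bar>h x\<bar> \<le> 2 * e ^ 3" for x
  proof -
    have "(sin x)\<^sup>2 / ((sin x)\<^sup>2 + e\<^sup>2) \<le> 1" using d[of x] by simp
    then have "2 * e ^ 3 * ((sin x)\<^sup>2 / ((sin x)\<^sup>2 + e\<^sup>2)) \<le> 2 * e ^ 3 * 1"
      using assms by (intro mult_left_mono) auto
    moreover have "0 \<le> h x" using assms by (simp add: h_def)
    ultimately show ?thesis by (simp add: h_def)
  qed
  then show "sq_gap (wave (1 / 2) e) (wave (- 1 / 2) e) \<le> 2 * e ^ 3"
    unfolding gap by (rule C0_norm_le)
qed

text \<open>The factor \<open>cos\<close> costs only a constant and makes the integral of \<open>profile e (sin x)\<close> explicit.\<close>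

lemma L1_norm_ge_quarter_period:
  assumes "continuous_on UNIV u" "((\<lambda>x. v x * cos x) has_integral I) {0..pi/2}"
    and "\<And>x. x \<in> {0..pi/2} \<Longrightarrow> 0 \<le> v x \<and> v x \<le> \<bar>u x\<bar>"
  shows "I \<le> L1_norm (2 * pi) u"
proof -
  have int: "(\<lambda>x. \<bar>u x\<bar>) integrable_on {a..b}" for a b
    by (intro integrable_continuous_interval continuous_intros continuous_on_subset[OF assms(1)]) auto
  have "I = integral {0..pi/2} (\<lambda>x. v x * cos x)" using assms(2) by (simp add: integral_unique)
  also have "\<dots> \<le> integral {0..pi/2} (\<lambda>x. \<bar>u x\<bar>)"
  proof (rule integral_le)
    fix x :: real assume x: "x \<in> {0..pi/2}"
    then have "v x * cos x \<le> v x * 1" using assms(3) by (intro mult_left_mono) auto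
    then show "v x * cos x \<le> \<bar>u x\<bar>" using assms(3)[OF x] by linarith
  qed (use assms(2) int in auto)
  also have "\<dots> \<le> integral {0..2*pi} (\<lambda>x. \<bar>u x\<bar>)"
    by (rule integral_subset_le) (use int in auto)
  finally show ?thesis by (simp add: L1_norm_def)
qed

section \<open>Lower bounds for the distance and failure of linear stability\<close>

text \<open>For \<open>s = 1\<close> the difference is the profile, whose weighted integral has
  primitive \<open>e^3 / 2 * ln ((sin x)^2 + e^2)\<close>; the logarithm comes from the endpoint 0.
  For \<open>s = -1\<close> the difference is \<open>2 * sin x\<close>, of fixed size, while
  \<open>e^3 * ln (1 / e) \<le> 1\<close>.\<close>

lemma wave_L1_norm_ge:
  assumes "0 < e" "e \<le> 1" and "s \<in> {1, -1 :: real}"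
  shows "e ^ 3 * ln (1 / e) \<le> L1_norm (2 * pi) (\<lambda>x. wave (1 / 2) e x - s * wave (- 1 / 2) e x)"
proof -
  have d: "(sin x)\<^sup>2 + e\<^sup>2 > 0" for x using assms by (simp add: add_nonneg_pos)
  show ?thesis
  proof (cases "s = 1")
    case True
    have u: "wave (1 / 2) e x - s * wave (- 1 / 2) e x = profile e (sin x)" for x
      by (simp add: wave_def True)
    have "((\<lambda>x. profile e (sin x) * cos x) has_integral
        e ^ 3 / 2 * ln ((sin (pi/2))\<^sup>2 + e\<^sup>2) - e ^ 3 / 2 * ln ((sin 0)\<^sup>2 + e\<^sup>2)) {0..pi/2}"
    proof (rule fundamental_theorem_of_calculus)
      fix x
      have "((\<lambda>x. ln ((sin x)\<^sup>2 + e\<^sup>2)) has_real_derivative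
          2 * (sin x * cos x / ((sin x)\<^sup>2 + e\<^sup>2))) (at x within {0..pi/2})"
        using d[of x] by (auto intro!: derivative_eq_intros)
      then have "((\<lambda>x. e ^ 3 / 2 * ln ((sin x)\<^sup>2 + e\<^sup>2)) has_real_derivative
          e ^ 3 / 2 * (2 * (sin x * cos x / ((sin x)\<^sup>2 + e\<^sup>2)))) (at x within {0..pi/2})"
        by (rule DERIV_cmult)
      then show "((\<lambda>x. e ^ 3 / 2 * ln ((sin x)\<^sup>2 + e\<^sup>2)) has_vector_derivative profile e (sin x) * cos x)
          (at x within {0..pi/2})"
        by (simp add: has_real_derivative_iff_has_vector_derivative[symmetric] profile_def mult_ac)
    qed simp
    moreover have "continuous_on UNIV (\<lambda>x. profile e (sin x))"
      unfolding profile_def using d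
      by (auto intro!: continuous_intros simp: less_imp_neq[THEN not_sym])
    moreover have "0 \<le> profile e (sin x)" if "x \<in> {0..pi/2}" for x
      using that assms by (auto simp: profile_def intro!: divide_nonneg_nonneg mult_nonneg_nonneg sin_ge_zero)
    ultimately have "e ^ 3 / 2 * ln ((sin (pi/2))\<^sup>2 + e\<^sup>2) - e ^ 3 / 2 * ln ((sin 0)\<^sup>2 + e\<^sup>2)
        \<le> L1_norm (2 * pi) (\<lambda>x. profile e (sin x))"
      by (intro L1_norm_ge_quarter_period) auto
    moreover have "ln ((sin 0)\<^sup>2 + e\<^sup>2) = - 2 * ln (1 / e)"
      using assms by (simp add: ln_realpow ln_div)
    moreover have "0 \<le> e ^ 3 / 2 * ln ((sin (pi/2))\<^sup>2 + e\<^sup>2)"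
      using assms by simp
    ultimately show ?thesis unfolding u by simp
  next
    case False
    then have s: "s = -1" using assms by simp
    have u: "wave (1 / 2) e x - s * wave (- 1 / 2) e x = 2 * sin x" for x
      by (simp add: wave_def s)
    have "((\<lambda>x. (2 * sin x) * cos x) has_integral (sin (pi/2))\<^sup>2 - (sin 0)\<^sup>2) {0..pi/2}"
      by (rule fundamental_theorem_of_calculus)
        (auto intro!: derivative_eq_intros simp: has_real_derivative_iff_has_vector_derivative[symmetric])
    then have "(sin (pi/2))\<^sup>2 - (sin 0)\<^sup>2 \<le> L1_norm (2 * pi) (\<lambda>x. 2 * sin x)"
      by (rule L1_norm_ge_quarter_period[rotated]) (auto intro!: continuous_intros sin_ge_zero)
    moreover have "e ^ 3 * ln (1 / e) \<le> 1"
    proof -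
      have "e ^ 3 * ln (1 / e) \<le> e ^ 3 * (1 / e)"
        using assms by (intro mult_left_mono less_imp_le[OF ln_less_self]) auto
      also have "\<dots> = e\<^sup>2" using assms by (simp add: power3_eq_cube power2_eq_square)
      also have "\<dots> \<le> 1" using assms by (auto intro: power_le_one)
      finally show ?thesis .
    qed
    ultimately show ?thesis unfolding u by simp
  qed
qed

text \<open>Rewrites the lower bound in terms of the gap: \<eta> is at most \<open>2 * e^3\<close>
  and \<open>ln (1 / \<eta>)\<close> at most \<open>3 * ln (1 / e)\<close>, whence the factor
  1/6.\<close>

lemma wave_L1_norm_ge_gap:
  fixes e :: real
  defines "\<eta> \<equiv> sq_gap (wave (1 / 2) e) (wave (- 1 / 2) e)"
  assumes e: "0 < e" "e \<le> 1" and s: "s \<in> {1, -1 :: real}"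
  shows "1 / 6 * (\<eta> * ln (1 / \<eta>)) \<le> L1_norm (2 * pi) (\<lambda>x. wave (1 / 2) e x - s * wave (- 1 / 2) e x)"
proof -
  have gap: "e ^ 3 \<le> \<eta>" "\<eta> \<le> 2 * e ^ 3" using wave_sq_gap[OF e] by (simp_all add: \<eta>_def)
  have "0 < e ^ 3" using e by simp
  then have "\<eta> > 0" using gap by linarith
  have "ln (1 / \<eta>) \<le> ln (1 / e ^ 3)"
    using gap \<open>0 < e ^ 3\<close> \<open>\<eta> > 0\<close> by (subst ln_le_cancel_iff) (auto intro!: divide_left_mono)
  also have "\<dots> = 3 * ln (1 / e)" using e by (simp add: ln_div ln_realpow)
  finally have "\<eta> * ln (1 / \<eta>) \<le> \<eta> * (3 * ln (1 / e))" using \<open>\<eta> > 0\<close> by (intro mult_left_mono) auto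
  also have "\<dots> \<le> 2 * e ^ 3 * (3 * ln (1 / e))"
    using gap e by (intro mult_right_mono) auto
  finally have "1 / 6 * (\<eta> * ln (1 / \<eta>)) \<le> e ^ 3 * ln (1 / e)" by simp
  also note wave_L1_norm_ge[OF e s]
  finally show ?thesis .
qed

lemma no_linear_bound:
  "\<not> (\<exists>C :: real. \<forall>f g. admissible_pair 15 (1 / 2) (2 * pi) f g \<longrightarrow>
      (\<exists>s \<in> {1, -1 :: real}. L1_norm (2 * pi) (\<lambda>x. f x - s * g x) \<le> C * sq_gap f g))"
proof
  assume "\<exists>C :: real. \<forall>f g. admissible_pair 15 (1 / 2) (2 * pi) f g \<longrightarrow>
      (\<exists>s \<in> {1, -1 :: real}. L1_norm (2 * pi) (\<lambda>x. f x - s * g x) \<le> C * sq_gap f g)"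
  then obtain C :: real where C: "\<And>f g. admissible_pair 15 (1 / 2) (2 * pi) f g \<Longrightarrow>
      \<exists>s \<in> {1, -1 :: real}. L1_norm (2 * pi) (\<lambda>x. f x - s * g x) \<le> C * sq_gap f g" by blast
  \<comment> \<open>Makes \<open>ln (1 / e) = 2 * \<bar>C\<bar> + 1\<close>, which beats the factor
    2 from the upper bound on the gap.\<close>
  define e where "e = exp (- (2 * \<bar>C\<bar> + 1))"
  have e: "0 < e" "e \<le> 1" by (simp_all add: e_def)
  obtain s :: real where s: "s \<in> {1, -1}"
    and le: "L1_norm (2 * pi) (\<lambda>x. wave (1 / 2) e x - s * wave (- 1 / 2) e x)
      \<le> C * sq_gap (wave (1 / 2) e) (wave (- 1 / 2) e)"
    using C[OF wave_admissible[OF e]] by blast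
  note wave_L1_norm_ge[OF e s]
  also note le
  also have "C * sq_gap (wave (1 / 2) e) (wave (- 1 / 2) e) \<le> \<bar>C\<bar> * (2 * e ^ 3)"
    using wave_sq_gap[OF e] zero_less_power[OF e(1), of 3] by (intro mult_mono) auto
  finally have "e ^ 3 * ln (1 / e) \<le> e ^ 3 * (2 * \<bar>C\<bar>)" by (simp add: mult_ac)
  then have "ln (1 / e) \<le> 2 * \<bar>C\<bar>" by (rule mult_left_le_imp_le) (use e in simp)
  then show False by (simp add: e_def ln_div)
qed

lemma wave_family_sharp:
  "\<exists>(c :: real) (e0 :: real) (F :: real \<Rightarrow> real \<Rightarrow> real) (G :: real \<Rightarrow> real \<Rightarrow> real).
     c > 0 \<and> e0 > 0 \<and>
     (\<forall>e. 0 < e \<and> e \<le> e0 \<longrightarrow>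
        admissible_pair 15 (1 / 2) (2 * pi) (F e) (G e) \<and> sq_gap (F e) (G e) > 0) \<and>
     ((\<lambda>e. sq_gap (F e) (G e)) \<longlongrightarrow> 0) (at_right 0) \<and>
     (\<forall>\<^sub>F e in at_right 0.
        (INF s \<in> {1, -1 :: real}. L1_norm (2 * pi) (\<lambda>x. F e x - s * G e x))
          \<ge> c * (sq_gap (F e) (G e) * ln (1 / sq_gap (F e) (G e))))"
proof (intro exI conjI allI impI)
  let ?\<eta> = "\<lambda>e. sq_gap (wave (1 / 2) e) (wave (- 1 / 2) e)"
  show "(1 / 6 :: real) > 0" "(1 :: real) > 0" by auto
  fix e :: real assume e: "0 < e \<and> e \<le> 1"
  then show "admissible_pair 15 (1 / 2) (2 * pi) (wave (1 / 2) e) (wave (- 1 / 2) e)"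
    by (intro wave_admissible) auto
  show "?\<eta> e > 0" using wave_sq_gap(1)[of e] e zero_less_power[of e 3] by linarith
next
  let ?\<eta> = "\<lambda>e. sq_gap (wave (1 / 2) e) (wave (- 1 / 2) e)"
  have ev: "\<forall>\<^sub>F e in at_right 0. 0 < e \<and> e \<le> (1 :: real)"
    unfolding eventually_at_right_field by (auto intro!: exI[of _ 1])
  have "((\<lambda>e. 2 * e ^ 3) \<longlongrightarrow> 2 * 0 ^ 3) (at_right (0 :: real))"
    by (intro tendsto_intros)
  then have "((\<lambda>e. 2 * e ^ 3) \<longlongrightarrow> 0) (at_right (0 :: real))" by simp
  moreover have "\<forall>\<^sub>F e in at_right 0. 0 \<le> ?\<eta> e"
    using ev
  proof eventually_elim
    case (elim e)
    then show ?case using wave_sq_gap(1)[of e] zero_less_power[of e 3] by linarith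
  qed
  moreover have "\<forall>\<^sub>F e in at_right 0. ?\<eta> e \<le> 2 * e ^ 3"
    using ev
  proof eventually_elim
    case (elim e)
    then show ?case using wave_sq_gap(2)[of e] by blast
  qed
  \<comment> \<open>The gap is squeezed between 0 and \<open>2 * e^3\<close>.\<close>
  ultimately show "(?\<eta> \<longlongrightarrow> 0) (at_right 0)"
    by (rule tendsto_sandwich[OF _ _ tendsto_const, rotated -1])
  show "\<forall>\<^sub>F e in at_right 0.
      (INF s \<in> {1, -1 :: real}. L1_norm (2 * pi) (\<lambda>x. wave (1 / 2) e x - s * wave (- 1 / 2) e x))
        \<ge> 1 / 6 * (?\<eta> e * ln (1 / ?\<eta> e))"
    using ev
  proof eventually_elim
    case (elim e)
    then show ?case by (intro cINF_greatest wave_L1_norm_ge_gap) auto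
  qed
qed

theorem theoremE:
  shows "(\<forall>B \<delta> L0 :: real. B > 0 \<longrightarrow> \<delta> > 0 \<longrightarrow> L0 > 0 \<longrightarrow>
            (\<forall>f g :: real \<Rightarrow> real. admissible_pair B \<delta> L0 f g \<longrightarrow>
              (\<exists>s \<in> {1, -1 :: real}.
                 L1_norm L0 (\<lambda>x. f x - s * g x) \<le> C_A B \<delta> L0 * rho (sq_gap f g))))
       \<and>
         (\<exists>B \<delta> L0 :: real. B > 0 \<and> \<delta> > 0 \<and> L0 > 0 \<and>
            \<not> (\<exists>C :: real. \<forall>f g :: real \<Rightarrow> real. admissible_pair B \<delta> L0 f g \<longrightarrow>
                 (\<exists>s \<in> {1, -1 :: real}. L1_norm L0 (\<lambda>x. f x - s * g x) \<le> C * sq_gap f g)) \<and>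
            (\<exists>(c :: real) (e0 :: real) (F :: real \<Rightarrow> real \<Rightarrow> real) (G :: real \<Rightarrow> real \<Rightarrow> real).
               c > 0 \<and> e0 > 0 \<and>
               (\<forall>e. 0 < e \<and> e \<le> e0 \<longrightarrow>
                  admissible_pair B \<delta> L0 (F e) (G e) \<and> sq_gap (F e) (G e) > 0) \<and>
               ((\<lambda>e. sq_gap (F e) (G e)) \<longlongrightarrow> 0) (at_right 0) \<and>
               (\<forall>\<^sub>F e in at_right 0.
                  (INF s \<in> {1, -1 :: real}. L1_norm L0 (\<lambda>x. F e x - s * G e x))
                    \<ge> c * (sq_gap (F e) (G e) * ln (1 / sq_gap (F e) (G e))))))"
proof (rule conjI)
  show "\<forall>B \<delta> L0 :: real. B > 0 \<longrightarrow> \<delta> > 0 \<longrightarrow> L0 > 0 \<longrightarrow>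
      (\<forall>f g :: real \<Rightarrow> real. admissible_pair B \<delta> L0 f g \<longrightarrow>
        (\<exists>s \<in> {1, -1 :: real}.
           L1_norm L0 (\<lambda>x. f x - s * g x) \<le> C_A B \<delta> L0 * rho (sq_gap f g)))"
    using L1_stability by blast
\<comment> \<open>The fixed parameters are those for which the waves were shown admissible.\<close>
qed (rule exI[of _ 15], rule exI[of _ "1 / 2"], rule exI[of _ "2 * pi"],
  use no_linear_bound wave_family_sharp in \<open>simp only: zero_less_numeral half_gt_zero_iff
    zero_less_one zero_less_divide_1_iff pi_gt_zero zero_less_mult_iff simp_thms\<close>)

end
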